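(* Let $(X,d)$ be a separable ultra-metric space in which all closed balls are compact, let $\mu$ be a Radon measure on $X$ with full support, let $\sigma$ be a distance distribution function, and let $\{P^t\}$ be the isotropic semigroup associated with $(d,\mu,\sigma)$, with Green function $g(x,y)$. Set $V(x,r)=\mu(B_r^*(x))$. Assume that there exist constants $1<c<c'<c''$ and $r_0\ge0$ such that for some $x\in X$ and all $r>r_0$ $$c'\le\frac{V(x,cr)}{V(x,r)}\le c''.$$ Then the semigroup $\{P^t\}$ is transient and, for all $y\in X$ such that $r:=d_*(x,y)>r_0$, we have $$g(x,y)\simeq\frac{r}{V(x,r)},$$ i.e. the ratio of the two sides is bounded above and below by positive constants independent of $y$.
   Context: Closed balls: $B_r(x)=\{y:d(x,y)\le r\}$. A distance distribution function is a strictly increasing left-continuous function $\sigma:[0,\infty]\to[0,1]$ with $\sigma(0+)=0$, $\sigma(\infty)=1$. With $\mathrm{Q}_rf(x)=\frac1{\mu(B_r(x))}\int_{B_r(x)}f\,d\mu$, the isotropic Markov operator associated with $(d,\mu,\sigma)$ is $P=\int_{[0,\infty)}\mathrm{Q}_r\,d\sigma(r)$; the isotropic semigroup is $\{P^t\}_{t\ge0}$, and its heat kernel with respect to $\mu$ is $p(t,x,y)=\int_{[d(x,y),\infty)}\frac{d\sigma^t(r)}{\mu(B_r(x))}$, where $\sigma^t(r)=(\sigma(r))^t$. Green operator (on non-negative Borel functions): $Gf(x)=\int_0^\infty P^tf(x)\,dt=\int_Xg(x,y)f(y)\,d\mu(y)$, with Green function $g(x,y)=\int_0^\infty p(t,x,y)\,dt\in[0,\infty]$.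 The semigroup is transient if $Gf$ is bounded whenever $f$ is bounded and has compact support. Intrinsic ultra-metric: $\frac1{d_*(x,y)}=\log\frac1{\sigma(d(x,y))}$ (with $d_*(x,x)=0$); $B^*_r(x)=\{y:d_*(x,y)\le r\}$. *)

theory Defs
  imports "HOL-Analysis.Analysis"
begin

definition radon_measure :: "'a::metric_space measure \<Rightarrow> bool" where
  "radon_measure \<mu> \<longleftrightarrow>
     sets \<mu> = sets borel \<and>
     (\<forall>K. compact K \<longrightarrow> emeasure \<mu> K < \<infinity>) \<and>
     (\<forall>A \<in> sets borel. emeasure \<mu> A = (SUP K \<in> {K. compact K \<and> K \<subseteq> A}. emeasure \<mu> K))"

definition full_support :: "'a::metric_space measure \<Rightarrow> bool" where
  "full_support \<mu> \<longleftrightarrow> (\<forall>U. open U \<longrightarrow> U \<noteq> {} \<longrightarrow> emeasure \<mu> U > 0)"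

text \<open>Left-continuity is required on all of \<open>[0,\<infinity>]\<close>, in particular at \<open>\<infinity>\<close> (at \<open>0\<close> it is void).\<close>

definition distance_distribution :: "(ennreal \<Rightarrow> real) \<Rightarrow> bool" where
  "distance_distribution \<sigma> \<longleftrightarrow>
     range \<sigma> \<subseteq> {0..1} \<and> strict_mono \<sigma> \<and>
     (\<forall>r. (\<sigma> \<longlongrightarrow> \<sigma> r) (at_left r)) \<and>
     (\<sigma> \<longlongrightarrow> 0) (at_right 0) \<and> \<sigma> \<infinity> = 1"

text \<open>
  The Lebesgue--Stieltjes measure \<open>d\<sigma>\<close> of a non-decreasing left-continuous \<open>\<sigma>\<close>, as a measure on
  the real line that vanishes on the negative half-line; half-open intervals \<open>[a,b)\<close> get mass
  \<open>\<sigma>(b) - \<sigma>(a)\<close> (see \<open>emeasure_stieltjes_left\<close>).  The library's \<open>interval_measure\<close> expects a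
  right-continuous distribution function, hence the reflection.
\<close>

definition stieltjes_left :: "(ennreal \<Rightarrow> real) \<Rightarrow> real measure" where
  "stieltjes_left \<sigma> = distr (interval_measure (\<lambda>x. - \<sigma> (ennreal (- x)))) borel uminus"

text \<open>
  Averages over closed balls.  For \<open>r = 0\<close> the ball is \<open>{x}\<close>, so the average is \<open>f x\<close>; this
  convention also makes sense if \<open>{x}\<close> is a null set.
\<close>

definition ball_average ::
  "'a::metric_space measure \<Rightarrow> real \<Rightarrow> ('a \<Rightarrow> ennreal) \<Rightarrow> 'a \<Rightarrow> ennreal" where
  "ball_average \<mu> r f x =
     (if r = 0 then f x
      else (\<integral>\<^sup>+ y \<in> cball x r. f y \<partial>\<mu>) / emeasure \<mu> (cball x r))"

definition isotropic_operator ::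
  "'a::metric_space measure \<Rightarrow> (ennreal \<Rightarrow> real) \<Rightarrow> ('a \<Rightarrow> ennreal) \<Rightarrow> 'a \<Rightarrow> ennreal" where
  "isotropic_operator \<mu> \<sigma> f x = (\<integral>\<^sup>+ r \<in> {0..}. ball_average \<mu> r f x \<partial>stieltjes_left \<sigma>)"

definition dd_power :: "(ennreal \<Rightarrow> real) \<Rightarrow> real \<Rightarrow> ennreal \<Rightarrow> real" where
  "dd_power \<sigma> t r = \<sigma> r powr t"

text \<open>
  The powers \<open>P\<^sup>t\<close> of the isotropic Markov operator \<open>P\<close>, acting on non-negative Borel functions.
  The averages \<open>Q\<^sub>r\<close> form a monotone family of orthogonal projections of \<open>L\<^sup>2(\<mu>)\<close>, so
  \<open>P = \<integral> Q\<^sub>r d\<sigma>(r)\<close> is (after integration by parts) a spectral resolution and functional calculus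
  gives \<open>P\<^sup>t = \<integral> Q\<^sub>r d\<sigma>\<^sup>t(r)\<close>.  The lemmas \<open>isotropic_semigroup_0\<close>, \<open>isotropic_semigroup_1\<close>,
  \<open>isotropic_semigroup_add\<close> and \<open>isotropic_semigroup_symmetric\<close> below show that this is indeed a
  \<open>\<mu>\<close>-symmetric semigroup starting at the identity and passing through \<open>P\<close> at time \<open>1\<close>.
\<close>

definition isotropic_semigroup ::
  "'a::metric_space measure \<Rightarrow> (ennreal \<Rightarrow> real) \<Rightarrow> real \<Rightarrow> ('a \<Rightarrow> ennreal) \<Rightarrow> 'a \<Rightarrow> ennreal" where
  "isotropic_semigroup \<mu> \<sigma> t = isotropic_operator \<mu> (dd_power \<sigma> t)"

definition heat_kernel ::
  "'a::metric_space measure \<Rightarrow> (ennreal \<Rightarrow> real) \<Rightarrow> real \<Rightarrow> 'a \<Rightarrow> 'a \<Rightarrow> ennreal" where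
  "heat_kernel \<mu> \<sigma> t x y =
     (\<integral>\<^sup>+ r \<in> {dist x y..}. 1 / emeasure \<mu> (cball x r) \<partial>stieltjes_left (dd_power \<sigma> t))"

definition green_function ::
  "'a::metric_space measure \<Rightarrow> (ennreal \<Rightarrow> real) \<Rightarrow> 'a \<Rightarrow> 'a \<Rightarrow> ennreal" where
  "green_function \<mu> \<sigma> x y = (\<integral>\<^sup>+ t \<in> {0..}. heat_kernel \<mu> \<sigma> t x y \<partial>lborel)"

definition green_operator ::
  "(real \<Rightarrow> ('a \<Rightarrow> ennreal) \<Rightarrow> 'a \<Rightarrow> ennreal) \<Rightarrow> ('a \<Rightarrow> ennreal) \<Rightarrow> 'a \<Rightarrow> ennreal" where
  "green_operator P f x = (\<integral>\<^sup>+ t \<in> {0..}. P t f x \<partial>lborel)"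

definition transient ::
  "(real \<Rightarrow> ('a::metric_space \<Rightarrow> ennreal) \<Rightarrow> 'a \<Rightarrow> ennreal) \<Rightarrow> bool" where
  "transient P \<longleftrightarrow>
     (\<forall>f \<in> borel_measurable borel.
        (\<exists>C<\<infinity>. \<forall>x. f x \<le> C) \<and> compact (closure {x. f x \<noteq> 0}) \<longrightarrow>
        (\<exists>C<\<infinity>. \<forall>x. green_operator P f x \<le> C))"

text \<open>For \<open>x \<noteq> y\<close> one has \<open>0 < \<sigma>(d(x,y)) < 1\<close>, so the division and logarithms are genuine.\<close>

definition intrinsic_dist :: "(ennreal \<Rightarrow> real) \<Rightarrow> 'a::metric_space \<Rightarrow> 'a \<Rightarrow> real" where
  "intrinsic_dist \<sigma> x y =
     (if x = y then 0 else 1 / ln (1 / \<sigma> (ennreal (dist x y))))"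

definition intrinsic_ball :: "(ennreal \<Rightarrow> real) \<Rightarrow> 'a::metric_space \<Rightarrow> real \<Rightarrow> 'a set" where
  "intrinsic_ball \<sigma> x r = {y. intrinsic_dist \<sigma> x y \<le> r}"

definition intrinsic_volume ::
  "'a::metric_space measure \<Rightarrow> (ennreal \<Rightarrow> real) \<Rightarrow> 'a \<Rightarrow> real \<Rightarrow> real" where
  "intrinsic_volume \<mu> \<sigma> x r = measure \<mu> (intrinsic_ball \<sigma> x r)"

lemma distance_distributionD:
  assumes "distance_distribution \<sigma>"
  shows "\<sigma> r \<ge> 0" "\<sigma> r \<le> 1" "r \<le> s \<Longrightarrow> \<sigma> r \<le> \<sigma> s" "(\<sigma> \<longlongrightarrow> \<sigma> r) (at_left r)"
    "\<sigma> 0 = 0" "\<sigma> \<infinity> = 1"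
proof -
  show ge: "\<sigma> r \<ge> 0" for r
    using assms unfolding distance_distribution_def by (force simp: subset_iff)
  show "\<sigma> r \<le> 1"
    using assms unfolding distance_distribution_def by (force simp: subset_iff)
  have mono: "\<sigma> r \<le> \<sigma> s" if "r \<le> s" for r s
    using assms that unfolding distance_distribution_def by (auto dest: strict_mono_mono monoD)
  then show "r \<le> s \<Longrightarrow> \<sigma> r \<le> \<sigma> s" .
  show "(\<sigma> \<longlongrightarrow> \<sigma> r) (at_left r)" "\<sigma> \<infinity> = 1"
    using assms unfolding distance_distribution_def by auto
  have lim: "filterlim (\<lambda>n. ennreal (inverse (real (Suc n)))) (at_right 0) sequentially"
    unfolding filterlim_at using tendsto_ennrealI[OF LIMSEQ_inverse_real_of_nat]
    by (auto intro!: always_eventually)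
  have "\<sigma> 0 \<le> 0"
  proof (rule tendsto_lowerbound)
    show "(\<lambda>n. \<sigma> (ennreal (inverse (real (Suc n))))) \<longlonglongrightarrow> 0"
      using assms lim unfolding distance_distribution_def by (auto intro: filterlim_compose)
    show "eventually (\<lambda>n. \<sigma> 0 \<le> \<sigma> (ennreal (inverse (real (Suc n))))) sequentially"
      by (auto simp: mono)
  qed auto
  then show "\<sigma> 0 = 0"
    using ge[of 0] by linarith
qed

lemma distance_distribution_mult:
  assumes "distance_distribution \<sigma>" "distance_distribution \<tau>"
  shows "distance_distribution (\<lambda>r. \<sigma> r * \<tau> r)"
  unfolding distance_distribution_def
proof (intro conjI allI)
  note D = distance_distributionD[OF assms(1)] distance_distributionD[OF assms(2)]
  show "range (\<lambda>r. \<sigma> r * \<tau> r) \<subseteq> {0..1}"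
    using D(1,2,7,8) by (auto intro!: mult_le_one)
  show "strict_mono (\<lambda>r. \<sigma> r * \<tau> r)"
  proof (rule strict_monoI)
    fix a b :: ennreal assume "a < b"
    then have "\<sigma> a < \<sigma> b" "\<tau> a < \<tau> b"
      using assms unfolding distance_distribution_def by (auto dest: strict_monoD)
    then show "\<sigma> a * \<tau> a < \<sigma> b * \<tau> b"
      using D by (intro mult_strict_mono') auto
  qed
  show "((\<lambda>r. \<sigma> r * \<tau> r) \<longlongrightarrow> \<sigma> r * \<tau> r) (at_left r)" for r
    using D by (intro tendsto_mult) auto
  have "((\<lambda>r. \<sigma> r * \<tau> r) \<longlongrightarrow> 0 * 0) (at_right 0)"
    using assms unfolding distance_distribution_def by (intro tendsto_mult) auto
  then show "((\<lambda>r. \<sigma> r * \<tau> r) \<longlongrightarrow> 0) (at_right 0)"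
    by simp
  show "\<sigma> \<infinity> * \<tau> \<infinity> = 1"
    using D by simp
qed

lemma distance_distribution_dd_power:
  assumes "distance_distribution \<sigma>" "t > 0"
  shows "distance_distribution (dd_power \<sigma> t)"
  unfolding distance_distribution_def dd_power_def
proof (intro conjI allI)
  note D = distance_distributionD[OF assms(1)]
  show "range (\<lambda>r. \<sigma> r powr t) \<subseteq> {0..1}"
    using D(1,2) assms(2) powr_mono2[of t "\<sigma> _" 1] by auto
  show "strict_mono (\<lambda>r. \<sigma> r powr t)"
    using assms D unfolding distance_distribution_def
    by (auto simp: strict_mono_def intro: powr_less_mono2)
  show "((\<lambda>r. \<sigma> r powr t) \<longlongrightarrow> \<sigma> r powr t) (at_left r)" for r
    using D assms(2) by (intro tendsto_powr2) auto
  have "((\<lambda>r. \<sigma> r powr t) \<longlongrightarrow> 0 powr t) (at_right 0)"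
    using assms D unfolding distance_distribution_def by (intro tendsto_powr2) auto
  then show "((\<lambda>r. \<sigma> r powr t) \<longlongrightarrow> 0) (at_right 0)"
    by simp
  show "\<sigma> \<infinity> powr t = 1"
    using D by simp
qed

lemma space_stieltjes_left [simp]: "space (stieltjes_left \<sigma>) = UNIV"
  and sets_stieltjes_left [simp, measurable_cong]: "sets (stieltjes_left \<sigma>) = sets borel"
  by (auto simp: stieltjes_left_def)

lemma emeasure_stieltjes_left:
  assumes mono: "\<And>r s. r \<le> s \<Longrightarrow> \<sigma> r \<le> \<sigma> s"
    and left: "\<And>r. r < \<infinity> \<Longrightarrow> (\<sigma> \<longlongrightarrow> \<sigma> r) (at_left r)"
    and "a \<le> b"
  shows "emeasure (stieltjes_left \<sigma>) {a..<b} = ennreal (\<sigma> (ennreal b) - \<sigma> (ennreal a))"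
proof -
  have "(\<lambda>x. - \<sigma> (ennreal (- x))) \<midarrow>c\<rightarrow> - \<sigma> (ennreal (- c))" if "c > 0" for c :: real
  proof -
    have "eventually (\<lambda>x. x > 0) (at c)"
      using that by (intro order_tendstoD(1)[OF tendsto_ident_at]) auto
    then have "eventually (\<lambda>x. - \<sigma> (ennreal (- x)) = - \<sigma> 0) (at c)"
      by eventually_elim (simp add: ennreal_neg)
    with that show ?thesis
      by (simp add: ennreal_neg tendsto_eventually)
  qed
  then have cont: "continuous (at_right c) (\<lambda>x. - \<sigma> (ennreal (- x)))" for c :: real
  proof (cases "c \<ge> 0")
    case True
    have "eventually (\<lambda>x. x > c) (at_right c)"
      by (simp add: eventually_at_right_less)
    then have "eventually (\<lambda>x. - \<sigma> (ennreal (- x)) = - \<sigma> (ennreal (- c))) (at_right c)"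
      by eventually_elim (use True in \<open>simp add: ennreal_neg\<close>)
    then show ?thesis
      by (simp add: continuous_within tendsto_eventually)
  next
    case False
    have "filterlim (\<lambda>x. ennreal (- x)) (at_left (ennreal (- c))) (at_right c)"
      unfolding filterlim_at
    proof
      have "eventually (\<lambda>x. x > c \<and> x < 0) (at_right c)"
        using False eventually_at_right_real[of c 0] by simp
      then show "eventually (\<lambda>x. ennreal (- x) \<in> {..<ennreal (- c)} \<and> ennreal (- x) \<noteq> ennreal (- c)) (at_right c)"
        by eventually_elim (auto simp: ennreal_less_iff)
      show "((\<lambda>x. ennreal (- x)) \<longlongrightarrow> ennreal (- c)) (at_right c)"
        by (intro tendsto_intros)
    qed
    from filterlim_compose[OF left this] show ?thesis
      by (auto simp: continuous_within intro: tendsto_minus)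
  qed
  have "emeasure (stieltjes_left \<sigma>) {a..<b} =
      emeasure (interval_measure (\<lambda>x. - \<sigma> (ennreal (- x)))) {- b<..- a}"
    unfolding stieltjes_left_def
    by (subst emeasure_distr) (auto intro!: arg_cong2[where f = emeasure])
  also have "\<dots> = ennreal (\<sigma> (ennreal b) - \<sigma> (ennreal a))"
    using assms(3) cont
    by (subst emeasure_interval_measure_Ioc) (auto intro!: mono ennreal_leI)
  finally show ?thesis .
qed

lemma emeasure_stieltjes_left_lessThan:
  assumes "distance_distribution \<sigma>"
  shows "emeasure (stieltjes_left \<sigma>) {..<b} = ennreal (\<sigma> (ennreal b))"
proof -
  note D = distance_distributionD[OF assms]
  let ?a = "\<lambda>n::nat. min b 0 - real n"
  have "(\<lambda>n. emeasure (stieltjes_left \<sigma>) {?a n..<b}) \<longlonglongrightarrow> emeasure (stieltjes_left \<sigma>) (\<Union>n. {?a n..<b})"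
    by (rule Lim_emeasure_incseq) (auto simp: incseq_def)
  also have "(\<Union>n. {?a n..<b}) = {..<b}"
  proof -
    have "\<exists>n. ?a n \<le> x" for x
      using real_arch_simple[of "min b 0 - x"] by (auto simp: algebra_simps)
    then show ?thesis by auto
  qed
  also have "(\<lambda>n. emeasure (stieltjes_left \<sigma>) {?a n..<b}) = (\<lambda>n. ennreal (\<sigma> (ennreal b)))"
  proof
    fix n
    have "emeasure (stieltjes_left \<sigma>) {?a n..<b} = ennreal (\<sigma> (ennreal b) - \<sigma> (ennreal (?a n)))"
      using D by (intro emeasure_stieltjes_left) auto
    also have "ennreal (?a n) = 0"
      by (intro ennreal_neg) auto
    finally show "emeasure (stieltjes_left \<sigma>) {?a n..<b} = ennreal (\<sigma> (ennreal b))"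
      using D by simp
  qed
  finally show ?thesis
    by (simp add: LIMSEQ_const_iff)
qed

lemma prob_space_stieltjes_left:
  assumes "distance_distribution \<sigma>"
  shows "emeasure (stieltjes_left \<sigma>) UNIV = 1" "AE r in stieltjes_left \<sigma>. r > 0"
    "sigma_finite_measure (stieltjes_left \<sigma>)"
proof -
  note D = distance_distributionD[OF assms] and L = emeasure_stieltjes_left_lessThan[OF assms]
  have top: "filterlim (\<lambda>n. ennreal (real n)) (at_left \<infinity>) sequentially"
    unfolding filterlim_at using of_nat_tendsto_top_ennreal
    by (auto simp: ennreal_of_nat_eq_real_of_nat top.not_eq_extremum)
  have "(\<lambda>n. emeasure (stieltjes_left \<sigma>) {..<real n}) \<longlonglongrightarrow> emeasure (stieltjes_left \<sigma>) (\<Union>n. {..<real n})"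
    by (rule Lim_emeasure_incseq) (auto simp: incseq_def)
  moreover have "(\<Union>n. {..<real n}) = UNIV"
    using reals_Archimedean2 by auto
  moreover have "(\<lambda>n. emeasure (stieltjes_left \<sigma>) {..<real n}) \<longlonglongrightarrow> ennreal 1"
    unfolding L using filterlim_compose[OF D(4) top] D(6)
    tendsto_ennrealI[of "\<lambda>n. \<sigma> (ennreal (real n))" 1] by simp
  ultimately show one: "emeasure (stieltjes_left \<sigma>) UNIV = 1"
    by (auto dest: LIMSEQ_unique)
  have "((\<lambda>n. \<sigma> (ennreal (inverse (real (Suc n))))) \<longlonglongrightarrow> 0)"
  proof -
    have "(\<sigma> \<longlongrightarrow> 0) (at_right 0)"
      using assms unfolding distance_distribution_def by auto
    moreover have "filterlim (\<lambda>n. ennreal (inverse (real (Suc n)))) (at_right 0) sequentially"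
      unfolding filterlim_at using tendsto_ennrealI[OF LIMSEQ_inverse_real_of_nat]
      by (auto intro!: always_eventually)
    ultimately show ?thesis
      by (rule filterlim_compose)
  qed
  then have "(\<lambda>n. emeasure (stieltjes_left \<sigma>) {..<inverse (real (Suc n))}) \<longlonglongrightarrow> 0"
    unfolding L using tendsto_ennrealI by fastforce
  moreover have "emeasure (stieltjes_left \<sigma>) {..0} \<le> emeasure (stieltjes_left \<sigma>) {..<inverse (real (Suc n))}" for n
  proof (rule emeasure_mono)
    show "{..0} \<subseteq> {..<inverse (real (Suc n))}"
      by (auto intro: le_less_trans)
  qed simp
  ultimately have "emeasure (stieltjes_left \<sigma>) {..0} \<le> 0"
    by (intro tendsto_lowerbound[where f = "\<lambda>n. emeasure (stieltjes_left \<sigma>) {..<inverse (real (Suc n))}"]) auto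
  then have "{..0} \<in> null_sets (stieltjes_left \<sigma>)"
    by (auto intro: null_setsI)
  then show "AE r in stieltjes_left \<sigma>. r > 0"
    by (rule AE_I') auto
  interpret finite_measure "stieltjes_left \<sigma>"
    by standard (simp add: one)
  show "sigma_finite_measure (stieltjes_left \<sigma>)"
    by unfold_locales
qed

text \<open>The maximum of independent random variables with distributions \<open>\<sigma>\<close>, \<open>\<tau>\<close> has distribution \<open>\<sigma>\<tau>\<close>.\<close>

lemma stieltjes_left_mult:
  assumes \<sigma>: "distance_distribution \<sigma>" and \<tau>: "distance_distribution \<tau>"
  shows "stieltjes_left (\<lambda>r. \<sigma> r * \<tau> r) =
    distr (stieltjes_left \<sigma> \<Otimes>\<^sub>M stieltjes_left \<tau>) borel (\<lambda>(r, s). max r s)"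
proof -
  interpret T: sigma_finite_measure "stieltjes_left \<tau>"
    using prob_space_stieltjes_left(3)[OF \<tau>] .
  let ?E = "range (lessThan :: real \<Rightarrow> real set)"
  let ?D = "distr (stieltjes_left \<sigma> \<Otimes>\<^sub>M stieltjes_left \<tau>) borel (\<lambda>(r, s). max r s)"
  note prod = distance_distribution_mult[OF \<sigma> \<tau>]
  have eq: "emeasure (stieltjes_left (\<lambda>r. \<sigma> r * \<tau> r)) {..<b} = emeasure ?D {..<b}" for b
  proof -
    have "emeasure ?D {..<b} = emeasure (stieltjes_left \<sigma> \<Otimes>\<^sub>M stieltjes_left \<tau>) ({..<b} \<times> {..<b})"
      by (subst emeasure_distr) (auto simp: space_pair_measure intro!: arg_cong2[where f = emeasure])
    also have "\<dots> = ennreal (\<sigma> (ennreal b)) * ennreal (\<tau> (ennreal b))"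
      by (subst T.emeasure_pair_measure_Times)
        (auto simp: emeasure_stieltjes_left_lessThan \<sigma> \<tau>)
    finally show ?thesis
      using distance_distributionD[OF \<sigma>] distance_distributionD[OF \<tau>]
      by (simp add: emeasure_stieltjes_left_lessThan[OF prod] ennreal_mult)
  qed
  show ?thesis
  proof (rule measure_eqI_generator_eq)
    show "Int_stable ?E"
    proof -
      have "{..<a} \<inter> {..<b} = {..<min a b}" for a b :: real
        by auto
      then show ?thesis
        by (auto simp: Int_stable_def)
    qed
    show "?E \<subseteq> Pow UNIV" by simp
    show "sets (stieltjes_left (\<lambda>r. \<sigma> r * \<tau> r)) = sigma_sets UNIV ?E" "sets ?D = sigma_sets UNIV ?E"
      by (simp_all add: borel_Iio)
    show "range (\<lambda>n. {..<real n}) \<subseteq> ?E" by auto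
    show "(\<Union>n. {..<real n}) = UNIV"
      using reals_Archimedean2 by auto
    show "emeasure (stieltjes_left (\<lambda>r. \<sigma> r * \<tau> r)) {..<real n} \<noteq> \<infinity>" for n
      by (simp add: emeasure_stieltjes_left_lessThan[OF prod])
  qed (use eq in auto)
qed

text \<open>The standing assumptions on the ultra-metric measure space, for the lemmas on \<open>P\<^sup>t\<close>.\<close>

locale ultrametric_measure_space =
  fixes \<mu> :: "'a::{metric_space, second_countable_topology} measure"
  assumes ultrametric: "\<And>u v w :: 'a. dist u w \<le> max (dist u v) (dist v w)"
    and compact_balls: "\<And>(u :: 'a) r. compact (cball u r)"
    and radon: "radon_measure \<mu>"
    and support: "full_support \<mu>"
begin

lemma sets_radon: "sets \<mu> = sets borel"
  using radon by (simp add: radon_measure_def)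

declare sets_radon [simp, measurable_cong]

lemma space_radon [simp]: "space \<mu> = UNIV"
  using sets_eq_imp_space_eq[OF sets_radon] by simp

lemma ultrametric_le: "dist u v \<le> r \<Longrightarrow> dist v w \<le> r \<Longrightarrow> dist u (w::'a) \<le> r"
  using ultrametric[of u w v] by linarith

lemma cball_eq: "dist u v \<le> r \<Longrightarrow> cball u r = cball (v::'a) r"
  using ultrametric_le by (auto simp: dist_commute)

lemma ball_finite: "emeasure \<mu> (cball u r) < \<infinity>"
  using radon compact_balls unfolding radon_measure_def by blast

lemma ball_pos: "r > 0 \<Longrightarrow> emeasure \<mu> (cball u r) > 0"
proof -
  assume "r > 0"
  then have "0 < emeasure \<mu> (ball u r)"
    using support by (auto simp: full_support_def)
  also have "\<dots> \<le> emeasure \<mu> (cball u r)"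
    by (intro emeasure_mono) auto
  finally show ?thesis .
qed

lemma sigma_finite_radon: "sigma_finite_measure \<mu>"
proof
  fix u :: 'a
  have "\<exists>n. dist u x \<le> real n" for x
    using real_arch_simple by auto
  then show "\<exists>A. countable A \<and> A \<subseteq> sets \<mu> \<and> \<Union> A = space \<mu> \<and> (\<forall>a\<in>A. emeasure \<mu> a \<noteq> \<infinity>)"
    using ball_finite[of u]
    by (intro exI[of _ "range (\<lambda>n::nat. cball u (real n))"]) (auto simp: less_top)
qed

interpretation sigma_finite_measure \<mu>
  by (rule sigma_finite_radon)

interpretation pair_sigma_finite \<mu> \<mu> ..

lemma measurable_volume [measurable]:
  assumes [measurable]: "g \<in> M \<rightarrow>\<^sub>M borel" "h \<in> M \<rightarrow>\<^sub>M borel"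
  shows "(\<lambda>z. emeasure \<mu> (cball (g z :: 'a) (h z))) \<in> borel_measurable M"
proof -
  have "emeasure \<mu> (cball (g z) (h z)) = (\<integral>\<^sup>+ y. (if dist (g z) y \<le> h z then 1 else 0) \<partial>\<mu>)" for z
  proof -
    have "emeasure \<mu> (cball (g z) (h z)) = (\<integral>\<^sup>+ y. indicator (cball (g z) (h z)) y \<partial>\<mu>)"
      by simp
    then show ?thesis
      by (simp add: indicator_def of_bool_def)
  qed
  then show ?thesis by simp
qed

lemma ball_average_altdef:
  "r \<noteq> 0 \<Longrightarrow> ball_average \<mu> r f x =
    (\<integral>\<^sup>+ y. f y * (if dist x y \<le> r then 1 else 0) \<partial>\<mu>) / emeasure \<mu> (cball x r)"
  by (auto simp: ball_average_def intro!: nn_integral_cong arg_cong2[where f = "(/)"]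
      split: split_indicator)

lemma measurable_ball_average [measurable]:
  assumes [measurable]: "f \<in> borel_measurable borel" "h \<in> M \<rightarrow>\<^sub>M borel" "g \<in> M \<rightarrow>\<^sub>M borel"
  shows "(\<lambda>z. ball_average \<mu> (h z) f (g z :: 'a)) \<in> borel_measurable M"
proof -
  have "(\<lambda>z. ball_average \<mu> (h z) f (g z)) = (\<lambda>z. if h z = 0 then f (g z) else
      (\<integral>\<^sup>+ y. f y * (if dist (g z) y \<le> h z then 1 else 0) \<partial>\<mu>) / emeasure \<mu> (cball (g z) (h z)))"
    by (auto simp: fun_eq_iff ball_average_def[of _ 0] ball_average_altdef)
  also have "\<dots> \<in> borel_measurable M"
    by measurable
  finally show ?thesis .
qed

lemma ball_average_comp:
  assumes [measurable]: "f \<in> borel_measurable borel" and "r > 0" "s > 0"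
  shows "ball_average \<mu> r (ball_average \<mu> s f) x = ball_average \<mu> (max r s) f (x::'a)"
proof (cases "r \<le> s")
  case True
  have "ball_average \<mu> s f y = ball_average \<mu> s f x" if "dist x y \<le> r" for y
    using that True cball_eq[of x y s] assms(3) by (simp add: ball_average_def)
  then have "(\<integral>\<^sup>+ y. ball_average \<mu> s f y * (if dist x y \<le> r then 1 else 0) \<partial>\<mu>) =
      (\<integral>\<^sup>+ y. ball_average \<mu> s f x * indicator (cball x r) y \<partial>\<mu>)"
    by (intro nn_integral_cong) (auto split: split_indicator)
  also have "\<dots> = ball_average \<mu> s f x * emeasure \<mu> (cball x r)"
    by (subst nn_integral_cmult_indicator) auto
  finally show ?thesis
    using True assms ball_finite[of x r] ball_pos[of r x]
    by (simp add: ball_average_altdef[of r] ennreal_mult_divide_eq less_top max_absorb2)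
next
  case False
  let ?V = "\<lambda>y. emeasure \<mu> (cball y s)"
  have "(\<integral>\<^sup>+ y. ball_average \<mu> s f y * (if dist x y \<le> r then 1 else 0) \<partial>\<mu>) =
      (\<integral>\<^sup>+ y. (\<integral>\<^sup>+ z. f z * (if dist y z \<le> s then 1 else 0) / ?V y * (if dist x y \<le> r then 1 else 0) \<partial>\<mu>) \<partial>\<mu>)"
    using assms by (intro nn_integral_cong)
      (simp add: ball_average_altdef divide_ennreal_def nn_integral_multc)
  also have "\<dots> = (\<integral>\<^sup>+ z. (\<integral>\<^sup>+ y. f z * (if dist y z \<le> s then 1 else 0) / ?V y * (if dist x y \<le> r then 1 else 0) \<partial>\<mu>) \<partial>\<mu>)"
    by (rule Fubini') measurable
  also have "\<dots> = (\<integral>\<^sup>+ z. (\<integral>\<^sup>+ y. f z * (if dist x z \<le> r then 1 else 0) / ?V z * indicator (cball z s) y \<partial>\<mu>) \<partial>\<mu>)"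
  proof (intro nn_integral_cong)
    fix y z
    show "f z * (if dist y z \<le> s then 1 else 0) / ?V y * (if dist x y \<le> r then 1 else 0) =
      f z * (if dist x z \<le> r then 1 else 0) / ?V z * indicator (cball z s) y"
    proof (cases "dist y z \<le> s")
      case True
      have "dist x y \<le> r \<longleftrightarrow> dist x z \<le> r"
        using True False ultrametric_le[of x y r z] ultrametric_le[of x z r y]
        by (auto simp: dist_commute)
      then show ?thesis
        using True cball_eq[OF True] by (auto simp: dist_commute split: split_indicator)
    qed (auto simp: dist_commute)
  qed
  also have "\<dots> = (\<integral>\<^sup>+ z. f z * (if dist x z \<le> r then 1 else 0) \<partial>\<mu>)"
  proof (intro nn_integral_cong)
    fix z
    have "?V z \<noteq> 0" "?V z \<noteq> top"
      using ball_finite[of z s] ball_pos[OF assms(3), of z] by auto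
    then show "(\<integral>\<^sup>+ y. f z * (if dist x z \<le> r then 1 else 0) / ?V z * indicator (cball z s) y \<partial>\<mu>) =
        f z * (if dist x z \<le> r then 1 else 0)"
      by (subst nn_integral_cmult_indicator) (auto simp: ennreal_divide_times ennreal_divide_self less_top zero_less_iff_neq_zero)
  qed
  finally show ?thesis
    using False assms by (simp add: ball_average_altdef max_def)
qed

lemma nn_integral_stieltjes_left_nonneg:
  assumes "distance_distribution \<sigma>"
  shows "(\<integral>\<^sup>+ r \<in> {0..}. h r \<partial>stieltjes_left \<sigma>) = (\<integral>\<^sup>+ r. h r \<partial>stieltjes_left \<sigma>)"
  using prob_space_stieltjes_left(2)[OF assms]
  by (intro nn_integral_cong_AE) (auto elim!: eventually_mono)

lemma isotropic_operator_comp: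
  assumes \<sigma>: "distance_distribution \<sigma>" and \<tau>: "distance_distribution \<tau>"
    and [measurable]: "f \<in> borel_measurable borel"
  shows "isotropic_operator \<mu> \<sigma> (isotropic_operator \<mu> \<tau> f) =
    isotropic_operator \<mu> (\<lambda>r. \<sigma> r * \<tau> r) (f :: 'a \<Rightarrow> ennreal)"
proof
  fix x :: 'a
  interpret T: sigma_finite_measure "stieltjes_left \<tau>"
    using prob_space_stieltjes_left(3)[OF \<tau>] .
  interpret P: pair_sigma_finite "stieltjes_left \<tau>" \<mu> ..
  let ?I = "\<lambda>\<sigma> h. (\<integral>\<^sup>+ r. h r \<partial>stieltjes_left \<sigma>)"
  have "isotropic_operator \<mu> \<sigma> (isotropic_operator \<mu> \<tau> f) x =
      (\<integral>\<^sup>+ r. (\<integral>\<^sup>+ s. ball_average \<mu> (max r s) f x \<partial>stieltjes_left \<tau>) \<partial>stieltjes_left \<sigma>)"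
    unfolding isotropic_operator_def nn_integral_stieltjes_left_nonneg[OF \<sigma>]
      nn_integral_stieltjes_left_nonneg[OF \<tau>]
    using prob_space_stieltjes_left(2)[OF \<sigma>]
  proof (intro nn_integral_cong_AE, eventually_elim)
    fix r :: real assume r: "r > 0"
    have "ball_average \<mu> r (\<lambda>y. ?I \<tau> (\<lambda>s. ball_average \<mu> s f y)) x =
      (\<integral>\<^sup>+ y. (\<integral>\<^sup>+ s. ball_average \<mu> s f y * (if dist x y \<le> r then 1 else 0) \<partial>stieltjes_left \<tau>) \<partial>\<mu>) /
        emeasure \<mu> (cball x r)"
      using r by (simp add: ball_average_altdef[of r] nn_integral_multc)
    also have "(\<integral>\<^sup>+ y. (\<integral>\<^sup>+ s. ball_average \<mu> s f y * (if dist x y \<le> r then 1 else 0) \<partial>stieltjes_left \<tau>) \<partial>\<mu>) =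
      (\<integral>\<^sup>+ s. (\<integral>\<^sup>+ y. ball_average \<mu> s f y * (if dist x y \<le> r then 1 else 0) \<partial>\<mu>) \<partial>stieltjes_left \<tau>)"
      by (rule P.Fubini') measurable
    also have "\<dots> / emeasure \<mu> (cball x r) = ?I \<tau> (\<lambda>s. ball_average \<mu> r (ball_average \<mu> s f) x)"
      using r by (simp add: ball_average_altdef[of r] divide_ennreal_def nn_integral_multc)
    also have "\<dots> = ?I \<tau> (\<lambda>s. ball_average \<mu> (max r s) f x)"
      using prob_space_stieltjes_left(2)[OF \<tau>]
      by (intro nn_integral_cong_AE, eventually_elim) (simp add: ball_average_comp r)
    finally show "ball_average \<mu> r (\<lambda>y. ?I \<tau> (\<lambda>s. ball_average \<mu> s f y)) x =
      ?I \<tau> (\<lambda>s. ball_average \<mu> (max r s) f x)" .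
  qed
  also have "\<dots> = (\<integral>\<^sup>+ (r, s). ball_average \<mu> (max r s) f x \<partial>(stieltjes_left \<sigma> \<Otimes>\<^sub>M stieltjes_left \<tau>))"
    by (subst T.nn_integral_fst[symmetric]) auto
  also have "\<dots> = ?I (\<lambda>r. \<sigma> r * \<tau> r) (\<lambda>r. ball_average \<mu> r f x)"
    unfolding stieltjes_left_mult[OF \<sigma> \<tau>]
    by (subst nn_integral_distr) (auto intro!: nn_integral_cong)
  also have "\<dots> = isotropic_operator \<mu> (\<lambda>r. \<sigma> r * \<tau> r) f x"
    by (simp add: isotropic_operator_def
        nn_integral_stieltjes_left_nonneg[OF distance_distribution_mult[OF \<sigma> \<tau>]])
  finally show "isotropic_operator \<mu> \<sigma> (isotropic_operator \<mu> \<tau> f) x = \<dots>" .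
qed

lemma ball_average_symmetric:
  assumes [measurable]: "f \<in> borel_measurable borel" "g \<in> borel_measurable borel" and "r > 0"
  shows "(\<integral>\<^sup>+ x. f x * ball_average \<mu> r g x \<partial>\<mu>) = (\<integral>\<^sup>+ x. ball_average \<mu> r f x * g x \<partial>\<mu>)"
proof -
  let ?V = "\<lambda>y. emeasure \<mu> (cball y r)"
  have "(\<integral>\<^sup>+ x. f x * ball_average \<mu> r g x \<partial>\<mu>) =
      (\<integral>\<^sup>+ x. (\<integral>\<^sup>+ y. f x * (g y * (if dist x y \<le> r then 1 else 0) / ?V x) \<partial>\<mu>) \<partial>\<mu>)"
    using assms by (intro nn_integral_cong)
      (simp add: ball_average_altdef divide_ennreal_def nn_integral_multc nn_integral_cmult)
  also have "\<dots> = (\<integral>\<^sup>+ y. (\<integral>\<^sup>+ x. f x * (g y * (if dist x y \<le> r then 1 else 0) / ?V x) \<partial>\<mu>) \<partial>\<mu>)"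
    by (rule Fubini') measurable
  also have "\<dots> = (\<integral>\<^sup>+ y. (\<integral>\<^sup>+ x. f x * (if dist y x \<le> r then 1 else 0) / ?V y * g y \<partial>\<mu>) \<partial>\<mu>)"
  proof (intro nn_integral_cong)
    fix x y
    show "f x * (g y * (if dist x y \<le> r then 1 else 0) / ?V x) = f x * (if dist y x \<le> r then 1 else 0) / ?V y * g y"
      using cball_eq[of x y r]
      by (cases "dist x y \<le> r") (auto simp: dist_commute divide_ennreal_def mult_ac)
  qed
  also have "\<dots> = (\<integral>\<^sup>+ x. ball_average \<mu> r f x * g x \<partial>\<mu>)"
    using assms by (intro nn_integral_cong)
      (simp add: ball_average_altdef divide_ennreal_def nn_integral_multc)
  finally show ?thesis .
qed

lemma isotropic_operator_symmetric:
  assumes \<sigma>: "distance_distribution \<sigma>"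
    and [measurable]: "f \<in> borel_measurable borel" "g \<in> borel_measurable borel"
  shows "(\<integral>\<^sup>+ x. f x * isotropic_operator \<mu> \<sigma> g x \<partial>\<mu>) =
    (\<integral>\<^sup>+ x. isotropic_operator \<mu> \<sigma> f x * g x \<partial>\<mu>)"
proof -
  interpret S: sigma_finite_measure "stieltjes_left \<sigma>"
    using prob_space_stieltjes_left(3)[OF \<sigma>] .
  interpret P: pair_sigma_finite "stieltjes_left \<sigma>" \<mu> ..
  have "(\<integral>\<^sup>+ x. f x * isotropic_operator \<mu> \<sigma> g x \<partial>\<mu>) =
      (\<integral>\<^sup>+ x. (\<integral>\<^sup>+ r. f x * ball_average \<mu> r g x \<partial>stieltjes_left \<sigma>) \<partial>\<mu>)"
    by (simp add: isotropic_operator_def nn_integral_stieltjes_left_nonneg[OF \<sigma>] nn_integral_cmult)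
  also have "\<dots> = (\<integral>\<^sup>+ r. (\<integral>\<^sup>+ x. f x * ball_average \<mu> r g x \<partial>\<mu>) \<partial>stieltjes_left \<sigma>)"
    by (rule P.Fubini') measurable
  also have "\<dots> = (\<integral>\<^sup>+ r. (\<integral>\<^sup>+ x. ball_average \<mu> r f x * g x \<partial>\<mu>) \<partial>stieltjes_left \<sigma>)"
    using prob_space_stieltjes_left(2)[OF \<sigma>]
    by (intro nn_integral_cong_AE, eventually_elim) (simp add: ball_average_symmetric)
  also have "\<dots> = (\<integral>\<^sup>+ x. (\<integral>\<^sup>+ r. ball_average \<mu> r f x * g x \<partial>stieltjes_left \<sigma>) \<partial>\<mu>)"
    by (rule P.Fubini'[symmetric]) measurable
  also have "\<dots> = (\<integral>\<^sup>+ x. isotropic_operator \<mu> \<sigma> f x * g x \<partial>\<mu>)"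
    by (simp add: isotropic_operator_def nn_integral_stieltjes_left_nonneg[OF \<sigma>] nn_integral_multc)
  finally show ?thesis .
qed

lemma isotropic_semigroup_0:
  assumes "distance_distribution \<sigma>"
  shows "isotropic_semigroup \<mu> \<sigma> 0 f = (f :: 'a \<Rightarrow> ennreal)"
proof
  fix x :: 'a
  note D = distance_distributionD[OF assms]
  let ?M = "stieltjes_left (dd_power \<sigma> 0)"
  have "\<sigma> r > 0" if "r > 0" for r
    using assms that D(5) unfolding distance_distribution_def by (metis strict_monoD)
  then have dd: "dd_power \<sigma> 0 = (\<lambda>r. if r = 0 then 0 else 1)"
    using D(5) by (force simp: dd_power_def zero_less_iff_neq_zero fun_eq_iff)
  have "(dd_power \<sigma> 0 \<longlongrightarrow> dd_power \<sigma> 0 r) (at_left r)" for r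
  proof (cases "r = 0")
    case True
    then have "at_left r = bot"
      by (auto simp: at_within_eq_bot_iff islimpt_def lessThan_def)
    then show ?thesis by simp
  next
    case False
    then have "eventually (\<lambda>s. s > 0) (at_left r)"
      by (intro order_tendstoD(1)[OF tendsto_ident_at]) (auto simp: zero_less_iff_neq_zero)
    then have "eventually (\<lambda>s. dd_power \<sigma> 0 s = dd_power \<sigma> 0 r) (at_left r)"
      by eventually_elim (use False in \<open>auto simp: dd\<close>)
    then show ?thesis
      by (rule tendsto_eventually)
  qed
  then have E: "emeasure ?M {a..<b} =
      ennreal (dd_power \<sigma> 0 (ennreal b) - dd_power \<sigma> 0 (ennreal a))" if "a \<le> b" for a b
    using that by (intro emeasure_stieltjes_left) (auto simp: dd)
  have "{inverse (real (Suc n))..<real (Suc n)} \<in> null_sets ?M" for n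
  proof -
    have "inverse (real (Suc n)) \<le> real (Suc n)"
      using inverse_le_1_iff[of "real (Suc n)"] by (simp add: field_simps)
    then have "emeasure ?M {inverse (real (Suc n))..<real (Suc n)} = ennreal (1 - 1)"
      by (subst E) (auto simp: dd)
    then show ?thesis
      by (intro null_setsI) auto
  qed
  then have "(\<Union>n. {inverse (real (Suc n))..<real (Suc n)}) \<in> null_sets ?M"
    by (intro null_sets_UN) auto
  moreover have "\<exists>n. inverse (real (Suc n)) \<le> r \<and> r < real (Suc n)" if r: "r > 0" for r :: real
  proof -
    obtain n where n: "max r (inverse r) < real (Suc n)"
      using reals_Archimedean2[of "max r (inverse r)"] by (metis less_trans of_nat_less_iff lessI)
    then have "inverse (real (Suc n)) < inverse (inverse r)"
      using r by (intro less_imp_inverse_less) auto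
    then show ?thesis
      using n by (auto intro!: exI[of _ n])
  qed
  ultimately have AE: "AE r in ?M. \<not> r > 0"
    by (intro AE_I') auto
  have one: "emeasure ?M {0..<1} = 1"
    by (subst E) (auto simp: dd)
  have "isotropic_semigroup \<mu> \<sigma> 0 f x = (\<integral>\<^sup>+ r. f x * indicator {0..<1} r \<partial>?M)"
    unfolding isotropic_semigroup_def isotropic_operator_def using AE
    by (intro nn_integral_cong_AE, eventually_elim)
      (auto simp: ball_average_def split: split_indicator)
  also have "\<dots> = f x"
    by (subst nn_integral_cmult_indicator) (simp_all add: one)
  finally show "isotropic_semigroup \<mu> \<sigma> 0 f x = f x" .
qed

lemma isotropic_semigroup_1:
  assumes "distance_distribution \<sigma>"
  shows "isotropic_semigroup \<mu> \<sigma> 1 = isotropic_operator \<mu> \<sigma>"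
proof -
  have "dd_power \<sigma> 1 = \<sigma>"
    using distance_distributionD(1)[OF assms] by (auto simp: dd_power_def)
  then show ?thesis
    by (simp add: isotropic_semigroup_def)
qed

lemma isotropic_semigroup_add:
  assumes "distance_distribution \<sigma>" "f \<in> borel_measurable borel" "s > 0" "t > 0"
  shows "isotropic_semigroup \<mu> \<sigma> (s + t) f =
    isotropic_semigroup \<mu> \<sigma> s (isotropic_semigroup \<mu> \<sigma> t (f :: 'a \<Rightarrow> ennreal))"
proof -
  have "dd_power \<sigma> (s + t) = (\<lambda>r. dd_power \<sigma> s r * dd_power \<sigma> t r)"
    by (auto simp: dd_power_def powr_add)
  then show ?thesis
    using assms
    by (simp add: isotropic_semigroup_def isotropic_operator_comp distance_distribution_dd_power)
qed

lemma isotropic_semigroup_symmetric: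
  assumes "distance_distribution \<sigma>" "f \<in> borel_measurable borel" "g \<in> borel_measurable borel" "t > 0"
  shows "(\<integral>\<^sup>+ x. f x * isotropic_semigroup \<mu> \<sigma> t g x \<partial>\<mu>) =
    (\<integral>\<^sup>+ x. isotropic_semigroup \<mu> \<sigma> t f x * g x \<partial>\<mu>)"
  using assms
  by (simp add: isotropic_semigroup_def isotropic_operator_symmetric distance_distribution_dd_power)

end

end

theory Submission
  imports Defs
begin

text \<open>
  In the intrinsic metric the distance distribution becomes \<open>exp (-1/u)\<close>: the measure \<open>d\<sigma>\<^sup>t\<close> is the
  image of \<open>d(exp (-t/u))\<close>, \<open>u > 0\<close>, under the map taking an intrinsic radius to the corresponding
  radius for \<open>d\<close>.  Its density \<open>t/u\<^sup>2 exp (-t/u)\<close> has integral 1 over \<open>t \<ge> 0\<close>, so Tonelli's theorem gives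
  \<open>Gf(z) = \<integral> Q\<^sup>*\<^sub>u f(z) du\<close> over \<open>u > 0\<close>, with \<open>Q\<^sup>*\<^sub>u\<close> the average over the intrinsic ball
  \<open>B\<^sup>*\<^sub>u(z)\<close>, and \<open>g(x,y) = \<integral> du/V(x,u)\<close> over \<open>u \<ge> r = d\<^sub>*(x,y)\<close>.
  The lower growth bound forces \<open>V(x,u) \<ge> (V(x,r)/c') (u/r)\<^sup>\<alpha>\<close> with \<open>\<alpha> = log c'/log c > 1\<close>, which bounds this
  integral from above; its part over \<open>[r,cr]\<close> bounds it from below by the upper growth bound.
  For transience, once \<open>u\<close> is so large that \<open>B\<^sup>*\<^sub>u(x)\<close> contains the support of \<open>f\<close>, the ball \<open>B\<^sup>*\<^sub>u(z)\<close> either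
  misses the support or equals \<open>B\<^sup>*\<^sub>u(x)\<close>, so \<open>Gf\<close> is controlled, uniformly in \<open>z\<close>, by the integral at \<open>x\<close>.
\<close>

section \<open>The density of \<open>d(exp (-t/u))\<close>, integrated over \<open>u\<close> and
  over \<open>t\<close>\<close>

text \<open>As a function of \<open>u\<close> this is the density of the Frechet law with
  distribution function \<open>exp (-t/u)\<close>; as a function of \<open>t\<close>, that of the
  Gamma law with shape 2 and scale \<open>u\<close>.\<close>

definition spectral_density :: "real \<Rightarrow> real \<Rightarrow> real" where
  "spectral_density t u = t / u\<^sup>2 * exp (- t / u)"

lemma spectral_density_measurable [measurable]:
  assumes [measurable]: "f \<in> borel_measurable M" "g \<in> borel_measurable M"
  shows "(\<lambda>z. spectral_density (f z) (g z)) \<in> borel_measurable M"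
  unfolding spectral_density_def by measurable

lemma nn_integral_spectral_density_radius:
  assumes t: "t > 0" and b: "b > 0"
  shows "(\<integral>\<^sup>+ u \<in> {0<..<b}. ennreal (spectral_density t u) \<partial>lborel) = ennreal (exp (- t / b))"
proof -
  let ?k = "spectral_density t" and ?F = "\<lambda>u. exp (- t / u)"
  have ei: "einterval (ereal 0) (ereal b) = {0<..<b}"
    by (auto simp: einterval_def)
  have deriv: "DERIV ?F u :> ?k u" if "u > 0" for u
    using that unfolding spectral_density_def
    by (auto intro!: derivative_eq_intros simp: power2_eq_square)
  have cont: "isCont ?k u" if "u > 0" for u
    using that unfolding spectral_density_def by (auto intro!: continuous_intros)
  \<comment> \<open>With the convention \<open>- t / 0 = 0\<close> the primitive takes the value 1
    at \<open>u = 0\<close>; the correct lower boundary term is its right limit 0.\<close>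
  have lim0: "(?F \<longlongrightarrow> 0) (at_right 0)"
  proof -
    have "filterlim (\<lambda>u. - t * inverse u) at_bot (at_right 0)"
      using filterlim_tendsto_neg_mult_at_bot[OF tendsto_const _ filterlim_inverse_at_top_right, of "- t"] t
      by simp
    then show ?thesis
      using filterlim_compose[OF exp_at_bot] by (simp add: field_simps)
  qed
  have limb: "(?F \<longlongrightarrow> ?F b) (at_left b)"
    using b by (intro tendsto_intros) auto
  note FTC = interval_integral_FTC_nonneg[of "ereal 0" "ereal b" ?F ?k 0 "?F b"]
  have "set_integrable lborel (einterval (ereal 0) (ereal b)) ?k \<and> (LBINT u=ereal 0..ereal b. ?k u) = ?F b - 0"
    using b t deriv cont lim0 limb
    by (intro conjI FTC) (auto simp: ereal_tendsto_simps spectral_density_def)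
  then have int: "integrable lborel (\<lambda>u. indicator {0<..<b} u * ?k u)"
    and eq: "(\<integral>u. indicator {0<..<b} u * ?k u \<partial>lborel) = ?F b"
    using b by (auto simp: ei set_integrable_def interval_lebesgue_integral_def set_lebesgue_integral_def)
  have "(\<integral>\<^sup>+ u \<in> {0<..<b}. ennreal (?k u) \<partial>lborel) = (\<integral>\<^sup>+ u. ennreal (indicator {0<..<b} u * ?k u) \<partial>lborel)"
    by (intro nn_integral_cong) (auto split: split_indicator)
  also have "\<dots> = ennreal (?F b)"
    unfolding eq[symmetric] using t
    by (intro nn_integral_eq_integral[OF int]) (auto simp: spectral_density_def split: split_indicator)
  finally show ?thesis .
qed

lemma nn_integral_spectral_density_time:
  assumes "u > 0"
  shows "(\<integral>\<^sup>+ t \<in> {0..}. ennreal (spectral_density t u) \<partial>lborel) = 1"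
proof -
  \<comment> \<open>A primitive in \<open>t\<close>, found by integration by parts.\<close>
  let ?F = "\<lambda>t. - (t / u + 1) * exp (- t / u)"
  have "(\<integral>\<^sup>+ t. ennreal (spectral_density t u) * indicator {0..} t \<partial>lborel) = ennreal (0 - ?F 0)"
  proof (rule nn_integral_FTC_atLeast[where F = ?F])
    show "DERIV ?F t :> spectral_density t u" for t
      using assms unfolding spectral_density_def
      by (auto intro!: derivative_eq_intros simp: power2_eq_square field_simps)
    have top: "filterlim (\<lambda>t. t / u) at_top at_top"
      using filterlim_tendsto_pos_mult_at_top[OF tendsto_const[of "inverse u"] _ filterlim_ident] assms
      by (simp add: field_simps)
    have "((\<lambda>s::real. - (s * exp (- s) + exp (- s))) \<longlongrightarrow> - (0 + 0)) at_top"
      using tendsto_power_div_exp_0[of 1] tendsto_power_div_exp_0[of 0]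
      by (intro tendsto_intros) (auto simp: exp_minus field_simps)
    from filterlim_compose[OF this top] show "(?F \<longlongrightarrow> 0) at_top"
      by (simp add: algebra_simps)
  qed (auto simp: spectral_density_def assms)
  then show ?thesis by simp
qed

section \<open>Intrinsic radii and the corresponding radii for \<open>d\<close>\<close>

text \<open>
  \<open>B\<^sup>*\<^sub>u(x)\<close> is the closed ball of this radius for \<open>d\<close>.  The supremum is attained because \<open>\<sigma>\<close> is
  left-continuous.
\<close>

definition intrinsic_radius :: "(ennreal \<Rightarrow> real) \<Rightarrow> real \<Rightarrow> real" where
  "intrinsic_radius \<sigma> u = (if u \<le> 0 then 0 else Sup {s. \<sigma> (ennreal s) \<le> exp (- 1 / u)})"

context
  fixes \<sigma> :: "ennreal \<Rightarrow> real"
  assumes \<sigma>: "distance_distribution \<sigma>"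
begin

lemma distance_distribution_less:
  "r < s \<Longrightarrow> \<sigma> r < \<sigma> s"
  using \<sigma> by (auto simp: distance_distribution_def dest: strict_monoD)

lemma distance_distribution_pos: "0 < r \<Longrightarrow> 0 < \<sigma> r"
  using distance_distribution_less[of 0 r] distance_distributionD(5)[OF \<sigma>] by simp

lemma distance_distribution_less_1: "\<sigma> (ennreal s) < 1"
  using distance_distribution_less[of "ennreal s" \<infinity>] distance_distributionD(6)[OF \<sigma>]
  by simp

text \<open>A Galois connection that replaces the supremum by inequalities for \<sigma>.
  Left-continuity at infinity bounds the set. Left-continuity at \<open>b\<close> puts the supremum
  into it: if \<sigma> exceeds the level at \<open>b\<close>, it already does so at some
  \<open>s < b\<close>, and \<open>s\<close> bounds the set. Negative \<open>b\<close> fit in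
  because \<open>ennreal\<close> truncates them to 0, where \<sigma> vanishes.\<close>

lemma intrinsic_radius_ge_iff:
  assumes u: "u > 0"
  shows "b \<le> intrinsic_radius \<sigma> u \<longleftrightarrow> \<sigma> (ennreal b) \<le> exp (- 1 / u)"
proof -
  note D = distance_distributionD[OF \<sigma>]
  let ?S = "{s. \<sigma> (ennreal s) \<le> exp (- 1 / u)}"
  have top: "filterlim (\<lambda>n. ennreal (real n)) (at_left \<infinity>) sequentially"
    unfolding filterlim_at using of_nat_tendsto_top_ennreal
    by (auto simp: ennreal_of_nat_eq_real_of_nat top.not_eq_extremum)
  have "exp (- 1 / u) < 1"
    using u by simp
  then have "eventually (\<lambda>n. \<sigma> (ennreal (real n)) > exp (- 1 / u)) sequentially"
    using order_tendstoD(1)[OF filterlim_compose[OF D(4) top]] D(6) by auto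
  then obtain n :: nat where n: "\<sigma> (ennreal (real n)) > exp (- 1 / u)"
    by (auto simp: eventually_sequentially)
  have upper: "s \<le> a" if "s \<in> ?S" "\<sigma> (ennreal a) > exp (- 1 / u)" for s a
    using that D(3)[of "ennreal a" "ennreal s"] by (fastforce intro: ennreal_leI)
  have bdd: "bdd_above ?S"
    by (rule bdd_aboveI[OF upper[OF _ n]])
  have zero: "0 \<in> ?S"
    using D(5) by simp
  show ?thesis
  proof
    assume "\<sigma> (ennreal b) \<le> exp (- 1 / u)"
    then show "b \<le> intrinsic_radius \<sigma> u"
      using u bdd by (auto simp: intrinsic_radius_def intro: cSup_upper)
  next
    assume b: "b \<le> intrinsic_radius \<sigma> u"
    show "\<sigma> (ennreal b) \<le> exp (- 1 / u)"
    proof (rule ccontr)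
      assume *: "\<not> \<sigma> (ennreal b) \<le> exp (- 1 / u)"
      then have "b > 0"
        using D(5) by (cases "b > 0") (auto simp: ennreal_neg)
      have "filterlim ennreal (at_left (ennreal b)) (at_left b)"
        unfolding filterlim_at
      proof
        have "eventually (\<lambda>s. s \<in> {0<..<b}) (at_left b)"
          using eventually_at_left_real[OF \<open>b > 0\<close>] .
        then show "eventually (\<lambda>s. ennreal s \<in> {..<ennreal b} \<and> ennreal s \<noteq> ennreal b) (at_left b)"
          by eventually_elim (auto simp: ennreal_less_iff)
      qed (intro tendsto_intros)
      from filterlim_compose[OF D(4) this]
      have "eventually (\<lambda>s. \<sigma> (ennreal s) > exp (- 1 / u)) (at_left b)"
        using * by (intro order_tendstoD(1)) auto
      moreover have "eventually (\<lambda>s. s \<in> {0<..<b}) (at_left b)"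
        using eventually_at_left_real[OF \<open>b > 0\<close>] .
      ultimately have "eventually (\<lambda>s. \<sigma> (ennreal s) > exp (- 1 / u) \<and> s < b) (at_left b)"
        by eventually_elim auto
      then obtain s where s: "\<sigma> (ennreal s) > exp (- 1 / u)" "s < b"
        using eventually_happens[of _ "at_left b"] by auto
      have "intrinsic_radius \<sigma> u \<le> s"
        using u zero upper[OF _ s(1)] cSup_least[of ?S s]
        by (auto simp: intrinsic_radius_def simp del: mem_Collect_eq)
      with b s show False by simp
    qed
  qed
qed

text \<open>Since \<sigma> tends to 0 at 0, some positive \<open>s\<close> stays below the level
  \<open>exp (-1/u)\<close>. Positivity gives the balls positive mass and avoids the special case
  \<open>r = 0\<close> of \<open>ball_average\<close>.\<close>

lemma intrinsic_radius_pos: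
  assumes "u > 0"
  shows "intrinsic_radius \<sigma> u > 0"
proof -
  have "filterlim (\<lambda>n. ennreal (inverse (real (Suc n)))) (at_right 0) sequentially"
    unfolding filterlim_at using tendsto_ennrealI[OF LIMSEQ_inverse_real_of_nat]
    by (auto intro!: always_eventually)
  moreover have "(\<sigma> \<longlongrightarrow> 0) (at_right 0)"
    using \<sigma> by (simp add: distance_distribution_def)
  ultimately have "(\<lambda>n. \<sigma> (ennreal (inverse (real (Suc n))))) \<longlonglongrightarrow> 0"
    by (rule filterlim_compose[rotated])
  then have "eventually (\<lambda>n. \<sigma> (ennreal (inverse (real (Suc n)))) < exp (- 1 / u)) sequentially"
    by (rule order_tendstoD) simp
  then obtain n where "\<sigma> (ennreal (inverse (real (Suc n)))) < exp (- 1 / u)"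
    by (auto simp: eventually_sequentially)
  then have "inverse (real (Suc n)) \<le> intrinsic_radius \<sigma> u"
    using assms by (subst intrinsic_radius_ge_iff) auto
  moreover have "inverse (real (Suc n)) > 0"
    by simp
  ultimately show ?thesis by linarith
qed

lemma intrinsic_radius_mono:
  assumes "u \<le> v"
  shows "intrinsic_radius \<sigma> u \<le> intrinsic_radius \<sigma> v"
proof (cases "u > 0")
  case True
  then have "\<sigma> (ennreal (intrinsic_radius \<sigma> u)) \<le> exp (- 1 / u)"
    using intrinsic_radius_ge_iff by blast
  also have "\<dots> \<le> exp (- 1 / v)"
    using True assms by (simp add: frac_le)
  finally show ?thesis
    using True assms by (subst intrinsic_radius_ge_iff) auto
next
  case False
  then show ?thesis
    using intrinsic_radius_pos[of v] by (cases "v > 0") (auto simp: intrinsic_radius_def)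
qed

lemma measurable_intrinsic_radius [measurable]: "intrinsic_radius \<sigma> \<in> borel_measurable borel"
  by (intro borel_measurable_mono monoI intrinsic_radius_mono)

text \<open>Solving \<open>1 / (- ln w) \<le> u\<close> for
  \<open>w = \<sigma> (ennreal (dist x y))\<close> gives \<open>w \<le> exp (-1/u)\<close>, which is
  the Galois connection at \<open>b = dist x y\<close>.\<close>

lemma intrinsic_dist_le_iff:
  assumes "u > 0"
  shows "intrinsic_dist \<sigma> x y \<le> u \<longleftrightarrow> dist x y \<le> intrinsic_radius \<sigma> u"
proof (cases "x = y")
  case True
  then show ?thesis
    using assms intrinsic_radius_pos[OF assms] by (simp add: intrinsic_dist_def)
next
  case False
  let ?w = "\<sigma> (ennreal (dist x y))"
  have w: "0 < ?w" "?w < 1"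
    using False by (auto intro: distance_distribution_pos distance_distribution_less_1)
  then have "intrinsic_dist \<sigma> x y \<le> u \<longleftrightarrow> 1 / (- ln ?w) \<le> u"
    using False by (simp add: intrinsic_dist_def ln_div)
  also have "\<dots> \<longleftrightarrow> 1 \<le> u * (- ln ?w)"
    using w by (subst pos_divide_le_eq) auto
  also have "\<dots> \<longleftrightarrow> ln ?w \<le> - 1 / u"
    using assms by (simp add: field_simps)
  also have "\<dots> \<longleftrightarrow> ?w \<le> exp (- 1 / u)"
    using w by (metis exp_ln exp_le_cancel_iff)
  finally show ?thesis
    using intrinsic_radius_ge_iff[OF assms] by simp
qed

lemma intrinsic_ball_eq_cball:
  "u > 0 \<Longrightarrow> intrinsic_ball \<sigma> x u = cball x (intrinsic_radius \<sigma> u)"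
  by (auto simp: intrinsic_ball_def intrinsic_dist_le_iff)

section \<open>Change of variables in the Stieltjes measures and integration over time\<close>

text \<open>It suffices to compare the half-lines \<open>{..<b}\<close>, an intersection-stable
  generator. For \<open>b > 0\<close>, negating the Galois connection turns
  \<open>intrinsic_radius \<sigma> u < b\<close> into \<open>u < 1 / (- ln w)\<close> with
  \<open>w = \<sigma> (ennreal b)\<close>, and the density gives \<open>(0, 1 / (- ln w))\<close>
  the mass \<open>exp (t * ln w) = w powr t\<close>.\<close>

lemma stieltjes_left_dd_power_eq_distr:
  assumes t: "t > 0"
  shows "stieltjes_left (dd_power \<sigma> t) =
    distr (density lborel (\<lambda>u. ennreal (spectral_density t u) * indicator {0<..} u)) borel
      (intrinsic_radius \<sigma>)" (is "?L = ?R")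
proof -
  note D = distance_distributionD[OF \<sigma>]
  note dd = distance_distribution_dd_power[OF \<sigma> t]
  let ?E = "range (lessThan :: real \<Rightarrow> real set)"
  have eq: "emeasure ?L {..<b} = emeasure ?R {..<b}" for b
  proof -
    have "emeasure ?R {..<b} =
        (\<integral>\<^sup>+ u. ennreal (spectral_density t u) * indicator {u. 0 < u \<and> intrinsic_radius \<sigma> u < b} u \<partial>lborel)"
      using measurable_sets[OF measurable_intrinsic_radius, of "{..<b}"]
      by (auto simp: emeasure_distr emeasure_density intro!: nn_integral_cong split: split_indicator)
    also have "\<dots> = ennreal (\<sigma> (ennreal b) powr t)"
    proof (cases "b > 0")
      case True
      let ?w = "\<sigma> (ennreal b)"
      have w: "0 < ?w" "?w < 1"
        using True by (auto intro: distance_distribution_pos distance_distribution_less_1)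
      have "intrinsic_radius \<sigma> u < b \<longleftrightarrow> u < 1 / (- ln ?w)" if "u > 0" for u
      proof -
        have "intrinsic_radius \<sigma> u < b \<longleftrightarrow> exp (- 1 / u) < ?w"
          using intrinsic_radius_ge_iff[OF that, of b] by linarith
        also have "\<dots> \<longleftrightarrow> - 1 / u < ln ?w"
          using w by (metis exp_ln exp_less_cancel_iff)
        also have "\<dots> \<longleftrightarrow> u * (- ln ?w) < 1"
          using that by (simp add: field_simps)
        also have "\<dots> \<longleftrightarrow> u < 1 / (- ln ?w)"
          using w by (subst pos_less_divide_eq) auto
        finally show ?thesis .
      qed
      then have "{u. 0 < u \<and> intrinsic_radius \<sigma> u < b} = {0<..<1 / (- ln ?w)}"
        by auto
      then show ?thesis
        using w t nn_integral_spectral_density_radius[OF t, of "1 / (- ln ?w)"]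
        by (simp add: powr_def)
    next
      case False
      then have "{u. 0 < u \<and> intrinsic_radius \<sigma> u < b} = {}"
        using intrinsic_radius_pos by fastforce
      then show ?thesis
        using False D(5) by (simp add: ennreal_neg)
    qed
    finally show ?thesis
      by (simp add: emeasure_stieltjes_left_lessThan[OF dd] dd_power_def)
  qed
  show ?thesis
  proof (rule measure_eqI_generator_eq)
    have "{..<a} \<inter> {..<b} = {..<min a b}" for a b :: real
      by auto
    then show "Int_stable ?E"
      by (auto simp: Int_stable_def)
    show "?E \<subseteq> Pow UNIV" by simp
    show "sets ?L = sigma_sets UNIV ?E" "sets ?R = sigma_sets UNIV ?E"
      by (simp_all add: borel_Iio)
    show "range (\<lambda>n. {..<real n}) \<subseteq> ?E" by auto
    show "(\<Union>n. {..<real n}) = UNIV"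
      using reals_Archimedean2 by auto
    show "emeasure ?L {..<real n} \<noteq> \<infinity>" for n
      by (simp add: emeasure_stieltjes_left_lessThan[OF dd])
  qed (use eq in auto)
qed

text \<open>Tonelli's theorem, as the density has total mass 1 in \<open>t\<close>. Taking for
  \<open>h\<close> the inverse ball volume cut off below \<open>dist x y\<close> yields the Green
  function; ball averages of \<open>f\<close> yield the Green operator.\<close>

lemma nn_integral_time_stieltjes_left:
  assumes h [measurable]: "h \<in> borel_measurable borel"
  shows "(\<integral>\<^sup>+ t \<in> {0..}. (\<integral>\<^sup>+ s. h s \<partial>stieltjes_left (dd_power \<sigma> t)) \<partial>lborel) =
    (\<integral>\<^sup>+ u \<in> {0<..}. h (intrinsic_radius \<sigma> u) \<partial>lborel)"
proof -
  let ?k = "\<lambda>t u. ennreal (spectral_density t u)" and ?\<phi> = "intrinsic_radius \<sigma>"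
  have "(\<integral>\<^sup>+ t \<in> {0..}. (\<integral>\<^sup>+ s. h s \<partial>stieltjes_left (dd_power \<sigma> t)) \<partial>lborel) =
      (\<integral>\<^sup>+ t. (\<integral>\<^sup>+ u. ?k t u * indicator {0..} t * (h (?\<phi> u) * indicator {0<..} u) \<partial>lborel) \<partial>lborel)"
  \<comment> \<open>The time 0 is discarded as a null set: there the density vanishes, whereas
    \<open>dd_power \<sigma> 0\<close> has a unit jump at 0.\<close>
  proof (intro nn_integral_cong_AE, use AE_lborel_singleton[of "0::real"] in eventually_elim)
    fix t :: real assume "t \<noteq> 0"
    show "(\<integral>\<^sup>+ s. h s \<partial>stieltjes_left (dd_power \<sigma> t)) * indicator {0..} t =
        (\<integral>\<^sup>+ u. ?k t u * indicator {0..} t * (h (?\<phi> u) * indicator {0<..} u) \<partial>lborel)"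
    proof (cases "t > 0")
      case True
      then show ?thesis
        by (auto simp: stieltjes_left_dd_power_eq_distr nn_integral_distr nn_integral_density
            intro!: nn_integral_cong split: split_indicator)
    qed (use \<open>t \<noteq> 0\<close> in auto)
  qed
  also have "\<dots> = (\<integral>\<^sup>+ u. (\<integral>\<^sup>+ t. ?k t u * indicator {0..} t * (h (?\<phi> u) * indicator {0<..} u) \<partial>lborel) \<partial>lborel)"
    by (rule lborel_pair.Fubini') measurable
  also have "\<dots> = (\<integral>\<^sup>+ u \<in> {0<..}. h (?\<phi> u) \<partial>lborel)"
    by (intro nn_integral_cong)
      (auto simp: nn_integral_multc nn_integral_spectral_density_time split: split_indicator)
  finally show ?thesis .
qed

end

section \<open>Volume growth and the integral of the inverse volume on the half-line\<close>

text \<open>Choose \<open>n\<close> with \<open>c^n r \<le> u < c^(n+1) r\<close> and iterate the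
  growth condition \<open>n\<close> times. Since
  \<open>(u/r) powr (ln c' / ln c) = c' powr (log c (u/r))\<close> is at most
  \<open>c'^(n+1)\<close>, rounding down costs a single factor \<open>c'\<close>.\<close>

lemma volume_growth_lower_bound:
  fixes V :: "real \<Rightarrow> real"
  assumes c: "1 < c" "c < c'" and r: "r > r\<^sub>0" "r\<^sub>0 \<ge> 0"
    and pos: "\<And>u. u > r\<^sub>0 \<Longrightarrow> V u > 0"
    and mono: "\<And>u v. r\<^sub>0 < u \<Longrightarrow> u \<le> v \<Longrightarrow> V u \<le> V v"
    and growth: "\<And>u. u > r\<^sub>0 \<Longrightarrow> c' * V u \<le> V (c * u)"
    and u: "u \<ge> r"
  shows "V r / c' * (u / r) powr (ln c' / ln c) \<le> V u"
proof -
  let ?\<alpha> = "ln c' / ln c"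
  have iter: "c' ^ n * V r \<le> V (c ^ n * r)" for n
  proof (induction n)
    case (Suc n)
    have "r \<le> c ^ n * r"
      using c r by simp
    then have "c' * V (c ^ n * r) \<le> V (c * (c ^ n * r))"
      using r by (intro growth) linarith
    moreover have "c' * (c' ^ n * V r) \<le> c' * V (c ^ n * r)"
      using Suc.IH c by (intro mult_left_mono) auto
    ultimately show ?case
      by (simp add: mult_ac)
  qed simp
  define n where "n = nat \<lfloor>log c (u / r)\<rfloor>"
  have ur: "u / r \<ge> 1"
    using u r by simp
  then have log: "log c (u / r) \<ge> 0"
    using c r u by simp
  have n: "real n \<le> log c (u / r)" "log c (u / r) < real n + 1"
    using log unfolding n_def by linarith+
  have "c ^ n \<le> u / r"
    using n(1) c ur by (simp add: le_log_iff powr_realpow)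
  then have le: "c ^ n * r \<le> u"
    using r by (simp add: field_simps)
  have "(u / r) powr ?\<alpha> \<le> c' ^ (n + 1)"
  proof -
    have "(u / r) powr ?\<alpha> = c' powr log c (u / r)"
      using u r c by (simp add: powr_def log_def)
    also have "\<dots> \<le> c' powr real (n + 1)"
      using n(2) c by (intro powr_mono) auto
    also have "\<dots> = c' ^ (n + 1)"
      using c by (intro powr_realpow) auto
    finally show ?thesis .
  qed
  then have "V r / c' * (u / r) powr ?\<alpha> \<le> V r / c' * c' ^ (n + 1)"
    using pos[OF r(1)] c by (intro mult_left_mono) auto
  also have "\<dots> = c' ^ n * V r"
    using c by simp
  also have "\<dots> \<le> V (c ^ n * r)"
    by (rule iter)
  also have "\<dots> \<le> V u"
  proof (rule mono[OF _ le])
    have "r \<le> c ^ n * r"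
      using c r by simp
    with r show "r\<^sub>0 < c ^ n * r" by linarith
  qed
  finally show ?thesis .
qed

text \<open>From \<open>c < c'\<close> the exponent \<alpha> exceeds 1, so
  \<open>(u/r) powr (-\<alpha>)\<close> is integrable over \<open>[r, \<infinity>)\<close>, with
  integral \<open>r / (\<alpha> - 1)\<close>. The factor \<open>c'\<close> in the constant is the
  rounding loss of the preceding bound.\<close>

lemma nn_integral_inverse_volume_le:
  fixes V :: "real \<Rightarrow> real"
  assumes c: "1 < c" "c < c'" and r: "r > r\<^sub>0" "r\<^sub>0 \<ge> 0"
    and pos: "\<And>u. u > r\<^sub>0 \<Longrightarrow> V u > 0"
    and mono: "\<And>u v. r\<^sub>0 < u \<Longrightarrow> u \<le> v \<Longrightarrow> V u \<le> V v"
    and growth: "\<And>u. u > r\<^sub>0 \<Longrightarrow> c' * V u \<le> V (c * u)"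
  shows "(\<integral>\<^sup>+ u \<in> {r..}. ennreal (1 / V u) \<partial>lborel) \<le> ennreal (c' / (ln c' / ln c - 1) * (r / V r))"
proof -
  define \<alpha> where "\<alpha> = ln c' / ln c"
  have \<alpha>: "\<alpha> > 1"
    using c by (simp add: \<alpha>_def)
  have V: "V r > 0" and r0: "r > 0"
    using pos r by auto
  let ?f = "\<lambda>u. c' / V r * (u / r) powr (- \<alpha>)"
  let ?F = "\<lambda>u. - (c' / V r * r / (\<alpha> - 1)) * (u / r) powr (1 - \<alpha>)"
  have "(\<integral>\<^sup>+ u \<in> {r..}. ennreal (1 / V u) \<partial>lborel) \<le> (\<integral>\<^sup>+ u \<in> {r..}. ennreal (?f u) \<partial>lborel)"
  proof (intro nn_integral_mono)
    fix u :: real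
    have "1 / V u \<le> ?f u" if "r \<le> u"
    proof -
      have le: "V r / c' * (u / r) powr \<alpha> \<le> V u"
        unfolding \<alpha>_def using c r that by (intro volume_growth_lower_bound[of c c' r\<^sub>0] pos mono growth)
      have "1 / V u \<le> 1 / (V r / c' * (u / r) powr \<alpha>)"
        using le V r0 c that by (intro divide_left_mono mult_pos_pos pos less_le_trans[OF r(1) that]) auto
      also have "\<dots> = ?f u"
        by (simp add: powr_minus field_simps)
      finally show ?thesis .
    qed
    then show "ennreal (1 / V u) * indicator {r..} u \<le> ennreal (?f u) * indicator {r..} u"
      by (auto intro: ennreal_leI split: split_indicator)
  qed
  also have "\<dots> = ennreal (0 - ?F r)"
  proof (rule nn_integral_FTC_atLeast[where F = ?F])
    show "DERIV ?F u :> ?f u" if "r \<le> u" for u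
    proof -
      have "((\<lambda>u. (u / r) powr (1 - \<alpha>)) has_real_derivative (1 - \<alpha>) * (u / r) powr (1 - \<alpha> - 1) * (1 / r)) (at u)"
        using that r0 by (auto intro!: derivative_eq_intros simp: divide_simps)
      from DERIV_cmult[OF this, of "- (c' / V r * r / (\<alpha> - 1))"]
      have "DERIV ?F u :> - (c' / V r * r / (\<alpha> - 1)) * ((1 - \<alpha>) * (u / r) powr (1 - \<alpha> - 1) * (1 / r))" .
      \<comment> \<open>The quotients stay uncancelled, so that with division by zero equal to 0 the
        identity is a rearrangement valid in every case; they are cancelled separately.\<close>
      moreover have "- (c' / V r * r / (\<alpha> - 1)) * ((1 - \<alpha>) * (u / r) powr (1 - \<alpha> - 1) * (1 / r)) =
          ((\<alpha> - 1) / (\<alpha> - 1)) * (r / r) * ?f u"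
        by (simp add: divide_simps) (simp add: algebra_simps)
      moreover have "((\<alpha> - 1) / (\<alpha> - 1)) * (r / r) * ?f u = ?f u"
        using \<alpha> r0 by simp
      ultimately show ?thesis
        by (simp only:)
    qed
    have "filterlim (\<lambda>u. u / r) at_top at_top"
      using filterlim_tendsto_pos_mult_at_top[OF tendsto_const[of "inverse r"] _ filterlim_ident] r0
      by (simp add: field_simps)
    then have "((\<lambda>u. (u / r) powr (1 - \<alpha>)) \<longlongrightarrow> 0) at_top"
      using \<alpha> by (intro tendsto_neg_powr) auto
    from tendsto_mult_left[OF this, of "- (c' / V r * r / (\<alpha> - 1))"] show "(?F \<longlongrightarrow> 0) at_top"
      by simp
  qed (use V c in auto)
  also have "0 - ?F r = c' / (\<alpha> - 1) * (r / V r)"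
    using r0 by simp
  finally show ?thesis
    unfolding \<alpha>_def .
qed

text \<open>The interval \<open>[r, c r]\<close> has length \<open>(c - 1) r\<close>, and on it
  monotonicity and the growth bound at \<open>r\<close> give
  \<open>V u \<le> c'' * V r\<close>.\<close>

lemma nn_integral_inverse_volume_ge:
  fixes V :: "real \<Rightarrow> real"
  assumes c: "1 < c" and r: "r > 0" and c'': "c'' > 0"
    and pos: "\<And>u. u \<ge> r \<Longrightarrow> V u > 0"
    and mono: "\<And>u v. r \<le> u \<Longrightarrow> u \<le> v \<Longrightarrow> V u \<le> V v"
    and growth: "V (c * r) \<le> c'' * V r"
  shows "ennreal ((c - 1) / c'' * (r / V r)) \<le> (\<integral>\<^sup>+ u \<in> {r..}. ennreal (1 / V u) \<partial>lborel)"
proof -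
  have V: "V r > 0"
    using pos by simp
  have "ennreal ((c - 1) / c'' * (r / V r)) = ennreal (1 / (c'' * V r)) * emeasure lborel {r..c * r}"
    using c r c'' V by (simp add: ennreal_mult[symmetric] field_simps)
  also have "\<dots> = (\<integral>\<^sup>+ u. ennreal (1 / (c'' * V r)) * indicator {r..c * r} u \<partial>lborel)"
    by (simp add: nn_integral_cmult_indicator)
  also have "\<dots> \<le> (\<integral>\<^sup>+ u \<in> {r..}. ennreal (1 / V u) \<partial>lborel)"
  proof (intro nn_integral_mono)
    fix u
    have "1 / (c'' * V r) \<le> 1 / V u" if "r \<le> u" "u \<le> c * r"
      using pos[OF that(1)] mono[OF that] growth c'' V by (intro divide_left_mono) auto
    then show "ennreal (1 / (c'' * V r)) * indicator {r..c * r} u \<le> ennreal (1 / V u) * indicator {r..} u"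
      by (auto intro: ennreal_leI split: split_indicator)
  qed
  finally show ?thesis .
qed

section \<open>Green function, Green operator and transience in intrinsic terms\<close>

context ultrametric_measure_space
begin

context
  fixes \<sigma> :: "ennreal \<Rightarrow> real"
  assumes \<sigma>: "distance_distribution \<sigma>"
begin

text \<open>Closed balls are compact and hence of finite mass, so the real-valued
  \<open>measure\<close> never falls back to its default value.\<close>

lemma emeasure_cball_intrinsic_radius:
  "u > 0 \<Longrightarrow> emeasure \<mu> (cball x (intrinsic_radius \<sigma> u)) = ennreal (intrinsic_volume \<mu> \<sigma> x u)"
  unfolding intrinsic_volume_def intrinsic_ball_eq_cball[OF \<sigma>]
  using ball_finite[of x "intrinsic_radius \<sigma> u"] by (intro emeasure_eq_ennreal_measure) auto

lemma intrinsic_volume_pos: "u > 0 \<Longrightarrow> intrinsic_volume \<mu> \<sigma> x u > 0"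
  using ball_pos[OF intrinsic_radius_pos[OF \<sigma>], of u x]
  by (simp add: emeasure_cball_intrinsic_radius)

lemma intrinsic_volume_mono:
  assumes "0 < u" "u \<le> v"
  shows "intrinsic_volume \<mu> \<sigma> x u \<le> intrinsic_volume \<mu> \<sigma> x v"
proof -
  have "emeasure \<mu> (cball x (intrinsic_radius \<sigma> u)) \<le> emeasure \<mu> (cball x (intrinsic_radius \<sigma> v))"
    using intrinsic_radius_mono[OF \<sigma> assms(2)] by (intro emeasure_mono) auto
  then show ?thesis
    using assms intrinsic_volume_pos[of v x]
    by (simp add: emeasure_cball_intrinsic_radius ennreal_le_iff)
qed

lemma divide_emeasure_cball_intrinsic_radius:
  assumes "u > 0"
  shows "a / emeasure \<mu> (cball x (intrinsic_radius \<sigma> u)) = a * ennreal (1 / intrinsic_volume \<mu> \<sigma> x u)"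
  using assms intrinsic_volume_pos[OF assms, of x]
  by (simp add: emeasure_cball_intrinsic_radius divide_ennreal_def inverse_ennreal inverse_eq_divide)

text \<open>For \<open>u > 0\<close> the cut-off
  \<open>dist x y \<le> intrinsic_radius \<sigma> u\<close> means
  \<open>intrinsic_dist \<sigma> x y \<le> u\<close>. Distinct points have positive intrinsic
  distance, so the new range of integration lies in \<open>u > 0\<close>.\<close>

lemma green_function_eq_nn_integral:
  assumes "x \<noteq> y"
  shows "green_function \<mu> \<sigma> x y =
    (\<integral>\<^sup>+ u \<in> {intrinsic_dist \<sigma> x y..}. ennreal (1 / intrinsic_volume \<mu> \<sigma> x u) \<partial>lborel)"
proof -
  let ?\<phi> = "intrinsic_radius \<sigma>"
  have "0 < \<sigma> (ennreal (dist x y))" "\<sigma> (ennreal (dist x y)) < 1"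
    using assms by (auto intro: distance_distribution_pos[OF \<sigma>] distance_distribution_less_1[OF \<sigma>])
  then have pos: "intrinsic_dist \<sigma> x y > 0"
    using assms by (simp add: intrinsic_dist_def)
  have "green_function \<mu> \<sigma> x y =
      (\<integral>\<^sup>+ u \<in> {0<..}. 1 / emeasure \<mu> (cball x (?\<phi> u)) * indicator {dist x y..} (?\<phi> u) \<partial>lborel)"
    unfolding green_function_def heat_kernel_def
    by (rule nn_integral_time_stieltjes_left[OF \<sigma>]) measurable
  also have "\<dots> = (\<integral>\<^sup>+ u \<in> {intrinsic_dist \<sigma> x y..}. ennreal (1 / intrinsic_volume \<mu> \<sigma> x u) \<partial>lborel)"
  proof (intro nn_integral_cong)
    fix u :: real
    show "1 / emeasure \<mu> (cball x (?\<phi> u)) * indicator {dist x y..} (?\<phi> u) * indicator {0<..} u =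
        ennreal (1 / intrinsic_volume \<mu> \<sigma> x u) * indicator {intrinsic_dist \<sigma> x y..} u"
    proof (cases "u > 0")
      case True
      then show ?thesis
        using intrinsic_dist_le_iff[OF \<sigma> True, of x y]
        by (simp add: divide_emeasure_cball_intrinsic_radius split: split_indicator)
    qed (use pos in auto)
  qed
  finally show ?thesis .
qed

lemma green_operator_eq_nn_integral:
  assumes [measurable]: "f \<in> borel_measurable borel"
  shows "green_operator (isotropic_semigroup \<mu> \<sigma>) f z =
    (\<integral>\<^sup>+ u \<in> {0<..}. ball_average \<mu> (intrinsic_radius \<sigma> u) f z \<partial>lborel)"
proof -
  have "green_operator (isotropic_semigroup \<mu> \<sigma>) f z =
      (\<integral>\<^sup>+ u \<in> {0<..}. ball_average \<mu> (intrinsic_radius \<sigma> u) f z *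
        indicator {0..} (intrinsic_radius \<sigma> u) \<partial>lborel)"
    unfolding green_operator_def isotropic_semigroup_def isotropic_operator_def
    by (rule nn_integral_time_stieltjes_left[OF \<sigma>]) measurable
  also have "\<dots> = (\<integral>\<^sup>+ u \<in> {0<..}. ball_average \<mu> (intrinsic_radius \<sigma> u) f z \<partial>lborel)"
    by (intro nn_integral_cong)
      (auto split: split_indicator dest: intrinsic_radius_pos[OF \<sigma>])
  finally show ?thesis .
qed

lemma ball_average_le:
  assumes "\<And>y. f y \<le> C" "r > 0"
  shows "ball_average \<mu> r f z \<le> C"
proof -
  let ?B = "cball z r"
  have "(\<integral>\<^sup>+ y \<in> ?B. f y \<partial>\<mu>) \<le> (\<integral>\<^sup>+ y. C * indicator ?B y \<partial>\<mu>)"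
    using assms by (intro nn_integral_mono mult_right_mono) auto
  also have "\<dots> = C * emeasure \<mu> ?B"
    by (simp add: nn_integral_cmult_indicator)
  finally have "ball_average \<mu> r f z \<le> C * emeasure \<mu> ?B / emeasure \<mu> ?B"
    using assms by (simp add: ball_average_def divide_right_mono_ennreal)
  also have "\<dots> = C"
    using ball_pos[OF assms(2), of z] ball_finite[of z r]
    by (intro ennreal_mult_divide_eq) auto
  finally show ?thesis .
qed

text \<open>Ultra-metric balls of equal radius are disjoint or equal. If the ball around
  \<open>z\<close> meets the support, it is therefore the ball around \<open>x\<close>, which makes
  the bound uniform in \<open>z\<close>.\<close>

lemma ball_average_intrinsic_radius_le:
  assumes C: "\<And>y. f y \<le> C" and supp: "{y. f y \<noteq> 0} \<subseteq> cball x (intrinsic_radius \<sigma> \<rho>)"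
    and u: "0 < \<rho>" "\<rho> \<le> u"
  shows "ball_average \<mu> (intrinsic_radius \<sigma> u) f z \<le>
    C * emeasure \<mu> (cball x (intrinsic_radius \<sigma> \<rho>)) * ennreal (1 / intrinsic_volume \<mu> \<sigma> x u)"
proof -
  let ?\<phi> = "intrinsic_radius \<sigma>"
  let ?B = "cball z (?\<phi> u)"
  have pos: "?\<phi> u > 0"
    using u by (intro intrinsic_radius_pos[OF \<sigma>]) auto
  show ?thesis
  proof (cases "\<forall>y\<in>?B. f y = 0")
    case True
    then have "(\<integral>\<^sup>+ y \<in> ?B. f y \<partial>\<mu>) = (\<integral>\<^sup>+ y. 0 \<partial>\<mu>)"
      by (intro nn_integral_cong) (auto split: split_indicator)
    then show ?thesis
      using pos by (simp add: ball_average_def)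
  next
    case False
    then obtain y where y: "dist z y \<le> ?\<phi> u" "f y \<noteq> 0"
      by auto
    then have "dist x y \<le> ?\<phi> \<rho>"
      using supp by auto
    then have "dist x y \<le> ?\<phi> u"
      using intrinsic_radius_mono[OF \<sigma> u(2)] by linarith
    then have B: "?B = cball x (?\<phi> u)"
      using cball_eq[OF y(1)] cball_eq[of x y "?\<phi> u"] by simp
    have "(\<integral>\<^sup>+ y \<in> ?B. f y \<partial>\<mu>) \<le> (\<integral>\<^sup>+ y. C * indicator (cball x (?\<phi> \<rho>)) y \<partial>\<mu>)"
    proof (intro nn_integral_mono)
      fix y
      show "f y * indicator ?B y \<le> C * indicator (cball x (?\<phi> \<rho>)) y"
        using C[of y] supp by (cases "f y = 0") (auto split: split_indicator)
    qed
    also have "\<dots> = C * emeasure \<mu> (cball x (?\<phi> \<rho>))"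
      by (simp add: nn_integral_cmult_indicator)
    finally have "(\<integral>\<^sup>+ y \<in> ?B. f y \<partial>\<mu>) / emeasure \<mu> ?B \<le>
        C * emeasure \<mu> (cball x (?\<phi> \<rho>)) / emeasure \<mu> (cball x (?\<phi> u))"
      unfolding B by (rule divide_right_mono_ennreal)
    then show ?thesis
      using pos u by (simp add: ball_average_def divide_emeasure_cball_intrinsic_radius)
  qed
qed

lemma transient_isotropic_semigroup:
  assumes \<rho>\<^sub>0: "\<rho>\<^sub>0 > 0"
    and fin: "(\<integral>\<^sup>+ u \<in> {\<rho>\<^sub>0..}. ennreal (1 / intrinsic_volume \<mu> \<sigma> x u) \<partial>lborel) < \<infinity>"
  shows "transient (isotropic_semigroup \<mu> \<sigma>)"
  unfolding transient_def
proof (intro ballI impI, elim conjE exE)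
  fix f :: "'a \<Rightarrow> ennreal" and C :: ennreal
  assume [measurable]: "f \<in> borel_measurable borel"
    and C: "C < \<infinity>" "\<forall>y. f y \<le> C"
    and K: "compact (closure {y. f y \<noteq> 0})"
  let ?\<phi> = "intrinsic_radius \<sigma>" and ?V = "intrinsic_volume \<mu> \<sigma> x"
  obtain R where R: "R > 0" "{y. f y \<noteq> 0} \<subseteq> cball x R"
  proof -
    have "bounded {y. f y \<noteq> 0}"
      using compact_imp_bounded[OF K] closure_subset bounded_subset by blast
    then obtain R where "{y. f y \<noteq> 0} \<subseteq> cball x R"
      using bounded_subset_ballD[of _ x] by (meson ball_subset_cball order_trans)
    then show ?thesis
      by (intro that[of "max R 1"]) (auto simp: subset_iff le_max_iff_disj)
  qed
  define w where "w = \<sigma> (ennreal R)"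
  have w: "0 < w" "w < 1"
    unfolding w_def using R by (auto intro: distance_distribution_pos[OF \<sigma>] distance_distribution_less_1[OF \<sigma>])
  \<comment> \<open>The intrinsic radius \<open>1 / (- ln w)\<close> corresponds to
    \<open>R\<close>, so the intrinsic ball of radius \<rho> around \<open>x\<close> contains the
    support; the maximum also keeps \<rho> in the range of the finite integral.\<close>
  define \<rho> where "\<rho> = max \<rho>\<^sub>0 (1 / (- ln w))"
  have \<rho>: "\<rho> > 0" "\<rho>\<^sub>0 \<le> \<rho>"
    using \<rho>\<^sub>0 by (auto simp: \<rho>_def)
  have "R \<le> ?\<phi> (1 / (- ln w))"
    using w by (subst intrinsic_radius_ge_iff[OF \<sigma>]) (auto simp: w_def)
  also have "\<dots> \<le> ?\<phi> \<rho>"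
    by (rule intrinsic_radius_mono[OF \<sigma>]) (simp add: \<rho>_def)
  finally have supp: "{y. f y \<noteq> 0} \<subseteq> cball x (?\<phi> \<rho>)"
    using R by auto
  let ?M = "emeasure \<mu> (cball x (?\<phi> \<rho>))"
  let ?I = "\<integral>\<^sup>+ u \<in> {\<rho>\<^sub>0..}. ennreal (1 / ?V u) \<partial>lborel"
  \<comment> \<open>Measurability is read off from the ball masses, with which \<open>?V\<close>
    agrees for positive \<open>u\<close>; the indicator confines \<open>u\<close> to that
    range.\<close>
  have V [measurable]: "(\<lambda>u. ennreal (1 / ?V u) * indicator {\<rho>\<^sub>0..} u) \<in> borel_measurable borel"
  proof -
    have "(\<lambda>u. 1 / emeasure \<mu> (cball x (?\<phi> u)) * indicator {\<rho>\<^sub>0..} u) \<in> borel_measurable borel"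
      using measurable_intrinsic_radius[OF \<sigma>] by measurable
    also have "(\<lambda>u. 1 / emeasure \<mu> (cball x (?\<phi> u)) * indicator {\<rho>\<^sub>0..} u) =
        (\<lambda>u. ennreal (1 / ?V u) * indicator {\<rho>\<^sub>0..} u)"
      using \<rho>\<^sub>0 by (auto simp: fun_eq_iff divide_emeasure_cball_intrinsic_radius split: split_indicator)
    finally show ?thesis .
  qed
  show "\<exists>C<\<infinity>. \<forall>z. green_operator (isotropic_semigroup \<mu> \<sigma>) f z \<le> C"
  proof (intro exI[of _ "C * ennreal \<rho> + C * ?M * ?I"] conjI allI)
    show "C * ennreal \<rho> + C * ?M * ?I < \<infinity>"
      using C fin ball_finite[of x "?\<phi> \<rho>"] by (simp add: ennreal_mult_less_top)
    fix z
    have "green_operator (isotropic_semigroup \<mu> \<sigma>) f z =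
        (\<integral>\<^sup>+ u \<in> {0<..}. ball_average \<mu> (?\<phi> u) f z \<partial>lborel)"
      by (rule green_operator_eq_nn_integral) measurable
    \<comment> \<open>Below \<rho> the average is at most \<open>C\<close>, above it the uniform
      bound applies. The second term already starts at \<open>\<rho>\<^sub>0\<close>, which only
      enlarges the right side and makes \<open>?I\<close> appear.\<close>
    also have "\<dots> \<le> (\<integral>\<^sup>+ u. C * indicator {0..\<rho>} u + C * ?M * (ennreal (1 / ?V u) * indicator {\<rho>\<^sub>0..} u) \<partial>lborel)"
    proof (intro nn_integral_mono)
      fix u :: real
      consider "u \<le> 0" | "0 < u" "u \<le> \<rho>" | "u > \<rho>"
        by linarith
      then show "ball_average \<mu> (?\<phi> u) f z * indicator {0<..} u \<le>
          C * indicator {0..\<rho>} u + C * ?M * (ennreal (1 / ?V u) * indicator {\<rho>\<^sub>0..} u)"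
      proof cases
        case 2
        then have "ball_average \<mu> (?\<phi> u) f z \<le> C"
          using C intrinsic_radius_pos[OF \<sigma>] by (intro ball_average_le) auto
        with 2 show ?thesis
          by (auto intro: add_increasing2)
      next
        case 3
        then have "ball_average \<mu> (?\<phi> u) f z \<le> C * ?M * ennreal (1 / ?V u)"
          using C supp \<rho> by (intro ball_average_intrinsic_radius_le) auto
        with 3 \<rho> show ?thesis
          by simp
      qed simp
    qed
    also have "\<dots> = C * ennreal \<rho> + C * ?M * ?I"
      using \<rho> by (simp add: nn_integral_add nn_integral_cmult nn_integral_cmult_indicator)
    finally show "green_operator (isotropic_semigroup \<mu> \<sigma>) f z \<le> C * ennreal \<rho> + C * ?M * ?I" .
  qed
qed

end

end

theorem theorem2p29:
  fixes \<mu> :: "'a::{metric_space, second_countable_topology} measure"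
    and \<sigma> :: "ennreal \<Rightarrow> real"
    and c c' c'' r\<^sub>0 :: real
    and x :: 'a
  assumes ultrametric: "\<And>u v w :: 'a. dist u w \<le> max (dist u v) (dist v w)"
    and compact_balls: "\<And>(u :: 'a) r. compact (cball u r)"
    and "radon_measure \<mu>"
    and "full_support \<mu>"
    and "distance_distribution \<sigma>"
    and "1 < c" and "c < c'" and "c' < c''" and "r\<^sub>0 \<ge> 0"
    and volume_growth: "\<And>r. r > r\<^sub>0 \<Longrightarrow>
          c' \<le> intrinsic_volume \<mu> \<sigma> x (c * r) / intrinsic_volume \<mu> \<sigma> x r \<and>
          intrinsic_volume \<mu> \<sigma> x (c * r) / intrinsic_volume \<mu> \<sigma> x r \<le> c''"
  shows "transient (isotropic_semigroup \<mu> \<sigma>) \<and>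
    (\<exists>C\<^sub>1 > 0. \<exists>C\<^sub>2 > 0. \<forall>y r. r = intrinsic_dist \<sigma> x y \<longrightarrow> r > r\<^sub>0 \<longrightarrow>
        ennreal (C\<^sub>1 * (r / intrinsic_volume \<mu> \<sigma> x r)) \<le> green_function \<mu> \<sigma> x y \<and>
        green_function \<mu> \<sigma> x y \<le> ennreal (C\<^sub>2 * (r / intrinsic_volume \<mu> \<sigma> x r)))"
proof -
  interpret ultrametric_measure_space \<mu>
    using assms(1-4) by unfold_locales
  note \<sigma> = \<open>distance_distribution \<sigma>\<close>
  let ?V = "intrinsic_volume \<mu> \<sigma> x" and ?I = "\<lambda>r. \<integral>\<^sup>+ u \<in> {r..}. ennreal (1 / intrinsic_volume \<mu> \<sigma> x u) \<partial>lborel"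
  let ?C\<^sub>1 = "(c - 1) / c''" and ?C\<^sub>2 = "c' / (ln c' / ln c - 1)"
  have V: "?V u > 0" if "u > r\<^sub>0" for u
    using that \<open>r\<^sub>0 \<ge> 0\<close> by (intro intrinsic_volume_pos[OF \<sigma>]) auto
  have mono: "?V u \<le> ?V v" if "r\<^sub>0 < u" "u \<le> v" for u v
    using that \<open>r\<^sub>0 \<ge> 0\<close> by (intro intrinsic_volume_mono[OF \<sigma>]) auto
  have growth: "c' * ?V u \<le> ?V (c * u)" "?V (c * u) \<le> c'' * ?V u" if "u > r\<^sub>0" for u
    using volume_growth[OF that] V[OF that] by (simp_all add: field_simps)
  have upper: "?I r \<le> ennreal (?C\<^sub>2 * (r / ?V r))" if "r > r\<^sub>0" for r
    by (rule nn_integral_inverse_volume_le[of c c' r\<^sub>0 r ?V]) (use assms(6,7,9) that V mono growth in auto)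
  have lower: "ennreal (?C\<^sub>1 * (r / ?V r)) \<le> ?I r" if "r > r\<^sub>0" for r
    by (rule nn_integral_inverse_volume_ge[of c r c'' ?V]) (use assms(6-9) that V mono growth in auto)
  have "transient (isotropic_semigroup \<mu> \<sigma>)"
  \<comment> \<open>The growth condition holds strictly above \<open>r\<^sub>0\<close>, which may be
    0, so the integral is started at a larger, positive radius.\<close>
  proof (rule transient_isotropic_semigroup[OF \<sigma>, of "r\<^sub>0 + 1" x])
    show "?I (r\<^sub>0 + 1) < \<infinity>"
      using upper[of "r\<^sub>0 + 1"] by (auto intro: le_less_trans)
  qed (use \<open>r\<^sub>0 \<ge> 0\<close> in auto)
  moreover have "?C\<^sub>1 > 0" "?C\<^sub>2 > 0"
    using assms(6-8) by auto
  \<comment> \<open>Here \<open>x \<noteq> y\<close>, because equal points have intrinsic distance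
    0, which does not exceed \<open>r\<^sub>0\<close>.\<close>
  moreover have "green_function \<mu> \<sigma> x y = ?I (intrinsic_dist \<sigma> x y)" if "intrinsic_dist \<sigma> x y > r\<^sub>0" for y
    using that \<open>r\<^sub>0 \<ge> 0\<close> by (intro green_function_eq_nn_integral[OF \<sigma>]) (auto simp: intrinsic_dist_def)
  ultimately show ?thesis
    using upper lower by (intro conjI exI[of _ ?C\<^sub>1] exI[of _ ?C\<^sub>2]) auto
qed

end
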